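(* Let $k\geqslant 0$ be an integer and $n\geqslant 21k+38$. Let $G_3(n,k)=K_{k+3}\vee(K_2\cup\overline{K}_{n-k-5})$. Then $$ex(n, 2P_5\cup kS_4)=e(G_3(n,k))=(k+3)n-\frac{k^2+7k+10}{2},$$ and $G_3(n,k)$ is, up to isomorphism, the unique $n$-vertex $(2P_5\cup kS_4)$-free graph with this number of edges.
   Context: All graphs are finite, simple and undirected. $K_m$ is the complete graph on $m$ vertices, $\overline{K}_m$ the edgeless graph on $m$ vertices, $P_m$ the path on $m$ vertices, and $S_{m}$ the star on $m+1$ vertices (so $S_4$ has 5 vertices). $G\cup H$ is the disjoint union, $tG$ the disjoint union of $t$ copies of $G$, and $G\vee H$ the join (disjoint union plus all edges between $V(G)$ and $V(H)$). $e(G)$ is the number of edges. For a graph $F$, $ex(n,F)$ is the maximum number of edges of an $n$-vertex graph containing no subgraph isomorphic to $F$. *)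

theory Defs
  imports Complex_Main
begin

datatype 'a graph = Graph (verts: "'a set") (edges: "'a set set")

definition simple_graph :: "'a graph \<Rightarrow> bool" where
  "simple_graph G \<longleftrightarrow> finite (verts G) \<and> (\<forall>e\<in>edges G. e \<subseteq> verts G \<and> card e = 2)"

definition order :: "'a graph \<Rightarrow> nat" where
  "order G = card (verts G)"

definition num_edges :: "'a graph \<Rightarrow> nat" where
  "num_edges G = card (edges G)"

definition subgraph :: "'a graph \<Rightarrow> 'a graph \<Rightarrow> bool" where
  "subgraph H G \<longleftrightarrow> verts H \<subseteq> verts G \<and> edges H \<subseteq> edges G"

definition isomorphic :: "'a graph \<Rightarrow> 'b graph \<Rightarrow> bool" where
  "isomorphic G H \<longleftrightarrow>
     (\<exists>f. bij_betw f (verts G) (verts H) \<and>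
          (\<forall>x\<in>verts G. \<forall>y\<in>verts G. {x, y} \<in> edges G \<longleftrightarrow> {f x, f y} \<in> edges H))"

text \<open>Subgraphs are not required to be induced.\<close>

definition graph_free :: "'f graph \<Rightarrow> 'a graph \<Rightarrow> bool" where
  "graph_free F G \<longleftrightarrow> \<not> (\<exists>H. simple_graph H \<and> subgraph H G \<and> isomorphic F H)"

text \<open>
  Every finite graph has an isomorphic copy on natural numbers, so taking vertices from
  \<^typ>\<open>nat\<close> loses nothing. The set below is finite (at most \<open>n choose 2\<close> edges), and nonempty
  whenever \<open>F\<close> has an edge, because the edgeless graph is then \<open>F\<close>-free.
\<close>

definition ex :: "nat \<Rightarrow> 'f graph \<Rightarrow> nat" where
  "ex n F = Max {num_edges G | G :: nat graph. simple_graph G \<and> order G = n \<and> graph_free F G}"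

definition complete_graph :: "nat \<Rightarrow> nat graph" where
  "complete_graph m = Graph {..<m} {{i, j} | i j. i < m \<and> j < m \<and> i \<noteq> j}"

definition edgeless_graph :: "nat \<Rightarrow> nat graph" where
  "edgeless_graph m = Graph {..<m} {}"

definition path_graph :: "nat \<Rightarrow> nat graph" where
  "path_graph m = Graph {..<m} {{i, Suc i} | i. Suc i < m}"

text \<open>The index counts the leaves; the centre is the vertex \<open>0\<close>.\<close>

definition star_graph :: "nat \<Rightarrow> nat graph" where
  "star_graph m = Graph {..m} {{0, i} | i. i \<in> {1..m}}"

definition disjoint_union :: "'a graph \<Rightarrow> 'b graph \<Rightarrow> ('a + 'b) graph" where
  "disjoint_union G H =
     Graph (verts G <+> verts H) ((`) Inl ` edges G \<union> (`) Inr ` edges H)"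

definition copies :: "nat \<Rightarrow> 'a graph \<Rightarrow> (nat \<times> 'a) graph" where
  "copies t G = Graph ({..<t} \<times> verts G) {Pair i ` e | i e. i < t \<and> e \<in> edges G}"

definition join :: "'a graph \<Rightarrow> 'b graph \<Rightarrow> ('a + 'b) graph" where
  "join G H =
     Graph (verts G <+> verts H)
       ((`) Inl ` edges G \<union> (`) Inr ` edges H \<union>
        {{Inl x, Inr y} | x y. x \<in> verts G \<and> y \<in> verts H})"

text \<open>The truncated subtraction below is exact when \<open>n \<ge> k + 5\<close>.\<close>

definition G3 :: "nat \<Rightarrow> nat \<Rightarrow> (nat + (nat + nat)) graph" where
  "G3 n k = join (complete_graph (k + 3))
                 (disjoint_union (complete_graph 2) (edgeless_graph (n - k - 5)))"

definition forbidden_forest :: "nat \<Rightarrow> (nat \<times> nat + nat \<times> nat) graph" where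
  "forbidden_forest k = disjoint_union (copies 2 (path_graph 5)) (copies k (star_graph 4))"

lemma simple_complete_graph: "simple_graph (complete_graph m)"
  by (auto simp: simple_graph_def complete_graph_def card_insert_if)

lemma simple_edgeless_graph: "simple_graph (edgeless_graph m)"
  by (simp add: simple_graph_def edgeless_graph_def)

lemma simple_path_graph: "simple_graph (path_graph m)"
  by (auto simp: simple_graph_def path_graph_def card_insert_if)

lemma simple_star_graph: "simple_graph (star_graph m)"
  by (auto simp: simple_graph_def star_graph_def card_insert_if)

lemma simple_disjoint_union:
  "simple_graph G \<Longrightarrow> simple_graph H \<Longrightarrow> simple_graph (disjoint_union G H)"
  by (fastforce simp: simple_graph_def disjoint_union_def card_image)

lemma simple_copies: "simple_graph G \<Longrightarrow> simple_graph (copies t G)"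
  by (fastforce simp: simple_graph_def copies_def card_image inj_on_def)

lemma simple_join: "simple_graph G \<Longrightarrow> simple_graph H \<Longrightarrow> simple_graph (join G H)"
  by (fastforce simp: simple_graph_def join_def card_image)

lemma simple_G3: "simple_graph (G3 n k)"
  unfolding G3_def
  by (intro simple_join simple_disjoint_union simple_complete_graph simple_edgeless_graph)

lemma order_G3: "n \<ge> k + 5 \<Longrightarrow> order (G3 n k) = n"
  by (simp add: order_def G3_def join_def disjoint_union_def complete_graph_def
      edgeless_graph_def card_Plus)

lemma simple_forbidden_forest: "simple_graph (forbidden_forest k)"
  unfolding forbidden_forest_def
  by (intro simple_disjoint_union simple_copies simple_path_graph simple_star_graph)

lemma order_forbidden_forest: "order (forbidden_forest k) = 5 * k + 10"
  by (simp add: order_def forbidden_forest_def disjoint_union_def copies_def path_graph_def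
      star_graph_def card_Plus card_cartesian_product)

end

theory Submission
  imports Defs
begin

text \<open>
  For \<open>k > 0\<close> a vertex of degree at least \<open>5 * k + 9\<close> is the centre of a star avoiding any
  copy of the forest for \<open>k - 1\<close>; deleting it reduces to \<open>k - 1\<close>. If there is no such vertex, take a copy
  \<open>W\<close> of the smaller forest: outside \<open>W\<close> all degrees are at most 3, and few edges leave \<open>W\<close>, because
  two vertices of a star of \<open>W\<close> with many outside neighbours would split into two stars, and an end of a
  path of \<open>W\<close> with many outside neighbours would start a new star. So the graph has too few edges.

  For \<open>k = 0\<close>, vertex sets meeting few edges may be deleted (see \<open>dense\<close>), so every set
  meets more than two edges per vertex. Deleting a \<open>P\<^sub>5\<close> leaves a \<open>P\<^sub>5\<close>-free graph, which has at most
  \<open>3 * n / 2\<close> edges; hence every \<open>P\<^sub>5\<close> meets many edges, and if three of its vertices meet few edges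
  avoiding the other two, those two have at least 8 common neighbours. Counting the edges between
  a \<open>P\<^sub>5\<close> and the rest shows that such a pair exists. It meets every \<open>P\<^sub>5\<close>, and the \<open>P\<^sub>5\<close>-free graph
  left by deleting it must be a star with one additional edge, fully joined to the pair.
\<close>

text \<open>For \<open>k = 0\<close> no lower bound on the order survives the deletions, so the
  estimates must not depend on it. Doubled edge counts grow at rate 4 and 6 per vertex in the two
  bounds that do survive. A path-free remainder (3 per vertex) together with one pair or one vertex
  of unbounded degree (2 per vertex) grows at rate 5, halfway between, so the order cancels and
  constants remain: the five vertices of a path must pay 23. A pair with at most 7 common neighbours
  leaves 16 for the other three vertices, while each local configuration offers only 15. In return,
  8 common neighbours are just enough, since the later rerouting avoids at most 7 vertices.

  The coefficient 21 is spent in the bounded-degree case. There \<open>2 * (k + 3) * n\<close>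
  supplies \<open>42 * k\<^sup>2\<close>, against \<open>36 * k\<^sup>2\<close>: 25 from edges
  inside \<open>W\<close>, 10 from edges leaving its stars, 1 from the formula for the extremal
  number.\<close>

locale adjacency =
  fixes adj :: "'a \<Rightarrow> 'a \<Rightarrow> bool"
  assumes adj_sym: "adj u v \<Longrightarrow> adj v u"
    and adj_irrefl: "\<not> adj u u"
begin

section \<open>Degrees and edge counts by degree sums\<close>

definition nbrs :: "'a set \<Rightarrow> 'a \<Rightarrow> 'a set" where
  "nbrs S v = {u \<in> S. adj v u}"

definition deg :: "'a set \<Rightarrow> 'a \<Rightarrow> nat" where
  "deg S v = card (nbrs S v)"

text \<open>Twice the number of edges spanned by \<open>S\<close>; all edge counts are done through this degree sum.\<close>

definition deg_sum :: "'a set \<Rightarrow> nat" where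
  "deg_sum S = (\<Sum>v\<in>S. deg S v)"

text \<open>Paths and stars are kept only as vertex sets: copies need not be induced and only their
  disjointness matters, so any spanning path of the set will do.\<close>

definition path5 :: "'a set \<Rightarrow> bool" where
  "path5 Y \<longleftrightarrow> (\<exists>a b c d e. distinct [a, b, c, d, e] \<and> adj a b \<and> adj b c \<and> adj c d \<and> adj d e
     \<and> Y = {a, b, c, d, e})"

definition star4 :: "'a set \<Rightarrow> bool" where
  "star4 Z \<longleftrightarrow> (\<exists>c L. card L = 4 \<and> Z = insert c L \<and> (\<forall>l\<in>L. adj c l))"

definition path5_free :: "'a set \<Rightarrow> bool" where
  "path5_free S \<longleftrightarrow> (\<forall>Y\<subseteq>S. \<not> path5 Y)"

definition packing :: "nat \<Rightarrow> 'a set \<Rightarrow> 'a set \<Rightarrow> 'a set set \<Rightarrow> bool" where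
  "packing k Y1 Y2 F \<longleftrightarrow> path5 Y1 \<and> path5 Y2 \<and> Y1 \<inter> Y2 = {} \<and> finite F \<and> card F = k
     \<and> (\<forall>Z\<in>F. star4 Z) \<and> pairwise disjnt F \<and> (Y1 \<union> Y2) \<inter> \<Union>F = {}"

definition packs :: "nat \<Rightarrow> 'a set \<Rightarrow> bool" where
  "packs k U \<longleftrightarrow> (\<exists>Y1 Y2 F. packing k Y1 Y2 F \<and> Y1 \<union> Y2 \<union> \<Union>F \<subseteq> U)"

text \<open>The graph \<open>G3\<close> recognised inside \<open>U\<close>: \<open>A\<close> is the
  clique of \<open>k + 3\<close> dominating vertices, and \<open>s t\<close> is the single edge
  outside it.\<close>

definition extremal :: "nat \<Rightarrow> 'a set \<Rightarrow> bool" where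
  "extremal k U \<longleftrightarrow> (\<exists>A s t. A \<subseteq> U \<and> card A = k + 3 \<and> s \<in> U - A \<and> t \<in> U - A \<and> s \<noteq> t
     \<and> (\<forall>u\<in>U. \<forall>v\<in>U. adj u v \<longleftrightarrow> u \<noteq> v \<and> (u \<in> A \<or> v \<in> A \<or> {u, v} = {s, t})))"

lemma adj_commute: "adj u v \<longleftrightarrow> adj v u"
  using adj_sym by blast

lemma adj_neq: "adj u v \<Longrightarrow> u \<noteq> v"
  using adj_irrefl by auto

lemma nbrs_subset: "nbrs S v \<subseteq> S"
  by (auto simp: nbrs_def)

lemma finite_nbrs [simp]: "finite S \<Longrightarrow> finite (nbrs S v)"
  by (simp add: nbrs_def)

lemma mem_nbrs [simp]: "u \<in> nbrs S v \<longleftrightarrow> u \<in> S \<and> adj v u"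
  by (simp add: nbrs_def)

lemma deg_le_card_superset: "nbrs S v \<subseteq> T \<Longrightarrow> finite T \<Longrightarrow> deg S v \<le> card T"
  unfolding deg_def by (rule card_mono)

lemma deg_mono: "S \<subseteq> T \<Longrightarrow> finite T \<Longrightarrow> deg S v \<le> deg T v"
  unfolding deg_def by (intro card_mono) (auto simp: nbrs_def)

lemma deg_le_card: "finite S \<Longrightarrow> deg S v \<le> card S"
  unfolding deg_def by (intro card_mono) (auto simp: nbrs_def)

lemma nbrs_remove_self: "nbrs (S - {v}) v = nbrs S v"
  using adj_irrefl by (auto simp: nbrs_def)

lemma deg_remove_self: "deg (S - {v}) v = deg S v"
  by (simp add: deg_def nbrs_remove_self)

lemma deg_less_card: "finite S \<Longrightarrow> v \<in> S \<Longrightarrow> deg S v \<le> card S - 1"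
  by (metis card_Diff_singleton deg_le_card deg_remove_self finite_Diff)

lemma deg_Un: "finite A \<Longrightarrow> finite B \<Longrightarrow> A \<inter> B = {} \<Longrightarrow> deg (A \<union> B) v = deg A v + deg B v"
proof -
  assume f: "finite A" "finite B" "A \<inter> B = {}"
  have "nbrs (A \<union> B) v = nbrs A v \<union> nbrs B v" by (auto simp: nbrs_def)
  moreover have "nbrs A v \<inter> nbrs B v = {}" using f by (auto simp: nbrs_def)
  ultimately show ?thesis using f by (simp add: deg_def card_Un_disjoint)
qed

lemma deg_empty [simp]: "deg {} v = 0"
  by (simp add: deg_def nbrs_def)

lemma sum_deg_swap:
  assumes "finite A" "finite B"
  shows "(\<Sum>v\<in>A. deg B v) = (\<Sum>v\<in>B. deg A v)"
proof -
  have deg: "deg S v = (\<Sum>u\<in>S. if adj v u then 1 else 0)" if "finite S" for S v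
    unfolding deg_def nbrs_def using that by (simp add: sum.If_cases Int_def)
  have "(\<Sum>v\<in>A. deg B v) = (\<Sum>v\<in>A. \<Sum>u\<in>B. if adj v u then 1 else 0)"
    using assms by (simp add: deg)
  also have "\<dots> = (\<Sum>u\<in>B. \<Sum>v\<in>A. if adj v u then 1 else 0)" by (rule sum.swap)
  also have "\<dots> = (\<Sum>u\<in>B. deg A u)" using assms by (simp add: deg adj_commute)
  finally show ?thesis .
qed

lemma deg_sum_Un:
  assumes "finite A" "finite B" "A \<inter> B = {}"
  shows "deg_sum (A \<union> B) = deg_sum A + deg_sum B + 2 * (\<Sum>v\<in>A. deg B v)"
proof -
  have "deg_sum (A \<union> B) = (\<Sum>v\<in>A. deg (A \<union> B) v) + (\<Sum>v\<in>B. deg (A \<union> B) v)"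
    unfolding deg_sum_def using assms by (rule sum.union_disjoint)
  also have "\<dots> = (\<Sum>v\<in>A. deg A v + deg B v) + (\<Sum>v\<in>B. deg A v + deg B v)"
    using assms by (simp add: deg_Un)
  also have "\<dots> = deg_sum A + deg_sum B + ((\<Sum>v\<in>A. deg B v) + (\<Sum>v\<in>B. deg A v))"
    by (simp add: deg_sum_def sum.distrib)
  also have "\<dots> = deg_sum A + deg_sum B + 2 * (\<Sum>v\<in>A. deg B v)"
    using sum_deg_swap[OF assms(1,2)] by simp
  finally show ?thesis .
qed

lemma deg_sum_split:
  assumes "finite U" "S \<subseteq> U"
  shows "deg_sum U = deg_sum S + deg_sum (U - S) + 2 * (\<Sum>v\<in>S. deg (U - S) v)"
proof -
  have "S \<union> (U - S) = U" using assms by auto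
  then show ?thesis using deg_sum_Un[of S "U - S"] assms by (simp add: finite_subset)
qed

lemma deg_sum_remove:
  assumes "finite S" "v \<in> S"
  shows "deg_sum S = deg_sum (S - {v}) + 2 * deg S v"
  using deg_sum_split[of S "{v}"] assms deg_remove_self[of S v] deg_remove_self[of "{v}" v]
  by (simp add: deg_sum_def)

lemma deg_sum_le_sq: "finite S \<Longrightarrow> deg_sum S \<le> card S * (card S - 1)"
  unfolding deg_sum_def using sum_bounded_above[of S "deg S" "card S - 1"] deg_less_card by simp

lemma path5I:
  assumes "distinct [a, b, c, d, e]"
    "adj a b \<or> adj b a" "adj b c \<or> adj c b" "adj c d \<or> adj d c" "adj d e \<or> adj e d"
  shows "path5 {a, b, c, d, e}"
proof -
  have "adj a b" "adj b c" "adj c d" "adj d e" using assms(2-5) by (metis adj_sym)+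
  then show ?thesis using assms(1) unfolding path5_def by blast
qed

lemma card_path5: "path5 Y \<Longrightarrow> card Y = 5"
  unfolding path5_def by (auto simp: card_insert_if)

lemma finite_path5: "path5 Y \<Longrightarrow> finite Y"
  unfolding path5_def by auto

lemma card_star4: "star4 Z \<Longrightarrow> card Z = 5"
proof -
  assume "star4 Z"
  then obtain c L where "card L = 4" "Z = insert c L" "\<forall>l\<in>L. adj c l" unfolding star4_def by blast
  moreover from this have "finite L" by (metis card.infinite zero_neq_numeral)
  moreover have "c \<notin> L" using calculation adj_irrefl by blast
  ultimately show ?thesis by simp
qed

lemma finite_star4: "star4 Z \<Longrightarrow> finite Z"
  using card_star4 card.infinite by (metis zero_neq_numeral)

lemma packingD:
  assumes "packing k Y1 Y2 F"
  shows "path5 Y1" "path5 Y2" "Y1 \<inter> Y2 = {}" "finite F" "card F = k"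
    "\<forall>Z\<in>F. star4 Z" "pairwise disjnt F" "(Y1 \<union> Y2) \<inter> \<Union>F = {}"
  using assms unfolding packing_def by blast+

lemma packsI: "packing k Y1 Y2 F \<Longrightarrow> Y1 \<union> Y2 \<union> \<Union>F \<subseteq> U \<Longrightarrow> packs k U"
  unfolding packs_def by blast

lemma packing_commute: "packing k Y1 Y2 F \<longleftrightarrow> packing k Y2 Y1 F"
  unfolding packing_def by (auto simp: Int_commute Un_commute)

lemma path5_free_mono: "path5_free S \<Longrightarrow> T \<subseteq> S \<Longrightarrow> path5_free T"
  unfolding path5_free_def by blast

lemma path5_freeD:
  assumes "path5_free S"
    "adj a b \<or> adj b a" "adj b c \<or> adj c b" "adj c d \<or> adj d c" "adj d e \<or> adj e d"
    "a \<in> S" "b \<in> S" "c \<in> S" "d \<in> S" "e \<in> S"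
    "a \<noteq> c" "a \<noteq> d" "a \<noteq> e" "b \<noteq> d" "b \<noteq> e" "c \<noteq> e"
  shows False
proof -
  have "a \<noteq> b" "b \<noteq> c" "c \<noteq> d" "d \<noteq> e" using assms(2-5) by (metis adj_irrefl)+
  then have "distinct [a, b, c, d, e]" using assms(11-16) by simp
  then have "path5 {a, b, c, d, e}" using assms(2-5) by (rule path5I)
  moreover have "{a, b, c, d, e} \<subseteq> S" using assms(6-10) by simp
  ultimately show False using assms(1) unfolding path5_free_def by blast
qed

lemma ex_nbrs:
  assumes "card X < deg S v" "finite X"
  shows "\<exists>u\<in>S. adj v u \<and> u \<notin> X"
proof -
  have "\<not> nbrs S v \<subseteq> X" using assms card_mono[of X "nbrs S v"] by (auto simp: deg_def)
  then obtain u where "u \<in> nbrs S v" "u \<notin> X" by blast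
  then show ?thesis by auto
qed

lemma ex_nbrs1: "deg S v \<ge> 2 \<Longrightarrow> \<exists>u\<in>S. adj v u \<and> u \<noteq> a"
  using ex_nbrs[of "{a}" S v] by simp

lemma ex_nbrs2: "deg S v \<ge> 3 \<Longrightarrow> \<exists>u\<in>S. adj v u \<and> u \<notin> {a, b}"
  using ex_nbrs[of "{a, b}" S v] card_insert_le_m1[of 2 "{b}" a] by simp

lemma ex_nbrs3: "deg S v \<ge> 4 \<Longrightarrow> \<exists>u\<in>S. adj v u \<and> u \<notin> {a, b, c}"
  using ex_nbrs[of "{a, b, c}" S v] card_insert_le_m1[of 3 "{b, c}" a] card_insert_le_m1[of 2 "{c}" b]
  by simp

subsection \<open>Graphs without a path on five vertices\<close>

text \<open>A vertex of degree at most 1 can be deleted. Once all degrees are at least 2, a vertex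
  of degree 4 always produces a path, so all degrees are at most 3. Disjoint copies of
  \<open>K_4\<close> attain the bound.\<close>

lemma path5_free_deg_sum:
  assumes "finite S" "path5_free S"
  shows "deg_sum S \<le> 3 * card S"
  using assms
proof (induction "card S" arbitrary: S rule: less_induct)
  case less
  show ?case
  proof (cases "\<exists>v\<in>S. deg S v \<le> 1")
    case True
    then obtain v where v: "v \<in> S" "deg S v \<le> 1" by auto
    have c: "card S > 0" using v less.prems card_gt_0_iff by blast
    have "path5_free (S - {v})" using less.prems(2) by (rule path5_free_mono) auto
    then have "deg_sum (S - {v}) \<le> 3 * card (S - {v})"
      using less.prems v c by (intro less.hyps) auto
    then show ?thesis using deg_sum_remove[of S v] v less.prems c by simp
  next
    case False
    then have ge2: "deg S v \<ge> 2" if "v \<in> S" for v using that by force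
    have le3: "deg S v \<le> 3" if v: "v \<in> S" for v
    proof (rule ccontr)
      assume "\<not> deg S v \<le> 3"
      then have d4: "deg S v \<ge> 4" by simp
      note dst = ex_nbrs3[OF d4]
      have other: "\<exists>u\<in>S. adj p u \<and> u \<noteq> q" if "p \<in> S" for p q
        by (rule ex_nbrs1[OF ge2[OF that]])
      note F = path5_freeD[OF less.prems(2)]
      \<comment> \<open>Otherwise \<open>x\<close> has a second neighbour \<open>y\<close>, and
        \<open>y x a v b\<close> is a path; \<open>b\<close> exists because \<open>v\<close> has
        four neighbours and only three vertices are excluded.\<close>
      have near: "adj v x" if a: "a \<in> S" "adj v a" and x: "x \<in> S" "adj a x" "x \<noteq> v" for a x
      proof (rule ccontr)
        assume nx: "\<not> adj v x"
        obtain y where y: "y \<in> S" "adj x y" "y \<noteq> a" using other[of x a] x by blast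
        have "y \<noteq> v" using y nx by (metis adj_sym)
        obtain b where b: "b \<in> S" "adj v b" "b \<notin> {y, x, a}" using dst[of y x a] by blast
        show False
          by (rule F[of y x a v b]) (use a x y b nx \<open>y \<noteq> v\<close> v in auto)
      qed
      obtain a where a: "a \<in> S" "adj v a" using dst[of v v v] by blast
      obtain b where b: "b \<in> S" "adj a b" "b \<noteq> v" using other[of a v] a by blast
      have vb: "adj v b" by (rule near[OF a b])
      obtain c where c: "c \<in> S" "adj v c" "c \<notin> {a, b}" using dst[of a b b] by blast
      obtain d where d: "d \<in> S" "adj c d" "d \<noteq> v" using other[of c v] c by blast
      obtain f where f: "f \<in> S" "adj v f" "f \<notin> {a, b, c}" using dst[of a b c] by blast
      have na: "v \<noteq> a" "v \<noteq> b" "v \<noteq> c" "a \<noteq> b" "v \<noteq> f" "c \<noteq> d"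
        using a b c d f vb by (metis adj_irrefl)+
      \<comment> \<open>The triangle \<open>v a b\<close> completes a path in every case: with the
        fourth neighbour \<open>f\<close> if \<open>d\<close> lies on the triangle, and as
        \<open>a b v c d\<close> otherwise.\<close>
      consider "d = a" | "d = b" | "d \<notin> {a, b}" by blast
      then show False
      proof cases
        case 1
        show False by (rule F[of f v c a b]) (use 1 a b c d f v na in auto)
      next
        case 2
        show False by (rule F[of f v c b a]) (use 2 a b c d f v na in auto)
      next
        case 3
        show False by (rule F[of a b v c d]) (use 3 a b c d vb v na in auto)
      qed
    qed
    show ?thesis unfolding deg_sum_def using sum_bounded_above[of S "deg S" 3] le3 by simp
  qed
qed

text \<open>
  For \<open>e = deg_sum U / 2\<close> and \<open>n = card U\<close> this says \<open>e \<ge> 3 * n - 5\<close> and \<open>e \<ge> 2 * n + 33\<close>. The two lines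
  cross at \<open>n = 38\<close>, and deleting vertices while losing at most two edges per vertex preserves
  both bounds, even when fewer than 38 vertices remain.
\<close>

definition dense :: "'a set \<Rightarrow> bool" where
  "dense U \<longleftrightarrow> 6 * card U \<le> deg_sum U + 10 \<and> 4 * card U + 66 \<le> deg_sum U"

lemma denseD: "dense U \<Longrightarrow> 6 * card U \<le> deg_sum U + 10" "dense U \<Longrightarrow> 4 * card U + 66 \<le> deg_sum U"
  by (simp_all add: dense_def)

definition tight :: "'a set \<Rightarrow> bool" where
  "tight U \<longleftrightarrow> (\<forall>S\<subseteq>U. S \<noteq> {} \<longrightarrow> deg_sum (U - S) + 4 * card S < deg_sum U)"

definition no_two_paths :: "'a set \<Rightarrow> bool" where
  "no_two_paths U \<longleftrightarrow> (\<forall>Y\<subseteq>U. path5 Y \<longrightarrow> path5_free (U - Y))"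

section \<open>Cost of a five-vertex path in a dense graph\<close>

text \<open>Inclusion-exclusion in \<open>U - {x, y}\<close>. The degree of \<open>y\<close> is
  taken after deleting \<open>x\<close>, so a possible edge \<open>x y\<close> counts once and the
  sum is the number of edges meeting the pair.\<close>

lemma deg_pair_le:
  assumes "finite U" "x \<in> U" "y \<in> U" "x \<noteq> y"
  shows "deg U x + deg (U - {x}) y + 1 \<le> card U + card (nbrs U x \<inter> nbrs U y)"
proof -
  let ?N = "nbrs U x - {y}" and ?M = "nbrs U y - {x}"
  have "card (?N \<union> ?M) + card (?N \<inter> ?M) = card ?N + card ?M"
    using assms card_Un_Int[of ?N ?M] by simp
  moreover have "?N \<union> ?M \<subseteq> U - {x, y}" using adj_irrefl by auto
  then have "card (?N \<union> ?M) \<le> card (U - {x, y})" using assms by (intro card_mono) auto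
  moreover have "card (U - {x, y}) + 2 = card U"
    using assms card_Diff_subset[of "{x, y}" U] card_mono[of U "{x, y}"] by simp
  moreover have "card (?N \<inter> ?M) \<le> card (nbrs U x \<inter> nbrs U y)"
    using assms by (intro card_mono) auto
  moreover have "deg (U - {x}) y = card ?M"
    unfolding deg_def by (rule arg_cong[where f = card]) auto
  moreover have "deg U x \<le> card (insert y ?N)"
    unfolding deg_def using assms by (intro card_mono) auto
  moreover have "card (insert y ?N) = Suc (card ?N)"
    using assms by (intro card_insert_disjoint) auto
  ultimately show ?thesis by linarith
qed

text \<open>Each edge meeting the list is charged to its endpoint that comes first in the list,
  hence exactly once.\<close>

lemma deg_sum_remove_list:
  assumes "finite S" "distinct vs" "set vs \<subseteq> S"
  shows "deg_sum S = deg_sum (S - set vs) + 2 * (\<Sum>i<length vs. deg (S - set (take i vs)) (vs ! i))"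
  using assms
proof (induction vs rule: rev_induct)
  case Nil
  then show ?case by simp
next
  case (snoc v vs)
  have "deg_sum (S - set vs) = deg_sum (S - set vs - {v}) + 2 * deg (S - set vs) v"
    using snoc.prems by (intro deg_sum_remove) auto
  moreover have "S - set vs - {v} = S - set (vs @ [v])" by auto
  ultimately show ?case using snoc by (simp add: nth_append)
qed

text \<open>Let \<open>n\<close> be the order and \<open>q\<close> the sum on the right. Deleting
  the path and bounding the remainder by \<open>3 * (n - 5)\<close> shows that the doubled edge
  count is at most \<open>5 * n - 17 + 2 * q\<close>. The bounds of \<open>dense\<close> then give
  \<open>n + 7\<close> \<le> \<open>2 * q\<close> and \<open>83 - n\<close> \<le>
  \<open>2 * q\<close>; adding them removes \<open>n\<close> and leaves \<open>90\<close> \<le>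
  \<open>4 * q\<close>.\<close>

lemma path_pair_bound:
  assumes U: "finite U" "dense U" and Y: "{x, y, u, v, w} \<subseteq> U" "distinct [x, y, u, v, w]"
    and free: "path5_free (U - {x, y, u, v, w})"
  shows "23 \<le> card (nbrs U x \<inter> nbrs U y) + deg (U - {x, y}) u + deg (U - {x, y, u}) v
    + deg (U - {x, y, u, v}) w"
proof -
  have "deg_sum U = deg_sum (U - {x, y, u, v, w}) + 2 * (deg U x + deg (U - {x}) y + deg (U - {x, y}) u
      + deg (U - {x, y, u}) v + deg (U - {x, y, u, v}) w)"
    using deg_sum_remove_list[of U "[x, y, u, v, w]"] U Y
    by (simp add: eval_nat_numeral insert_commute)
  moreover have "deg_sum (U - {x, y, u, v, w}) \<le> 3 * card (U - {x, y, u, v, w})"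
    using U free by (intro path5_free_deg_sum) auto
  moreover have "card (U - {x, y, u, v, w}) + 5 = card U"
    using U Y card_Diff_subset[of "{x, y, u, v, w}" U] card_mono[of U "{x, y, u, v, w}"] by simp
  moreover have "deg U x + deg (U - {x}) y + 1 \<le> card U + card (nbrs U x \<inter> nbrs U y)"
    using U Y by (intro deg_pair_le) auto
  ultimately show ?thesis using denseD[OF U(2)] by presburger
qed

text \<open>The same calculation with one vertex \<open>x\<close> in place of the pair: its degree
  is at most \<open>n - 1\<close>, and the other four vertices have to supply the 23.\<close>

lemma path_vertex_bound:
  assumes U: "finite U" "dense U" and Y: "{x, t, u, v, w} \<subseteq> U" "distinct [x, t, u, v, w]"
    and free: "path5_free (U - {x, t, u, v, w})"
  shows "23 \<le> deg (U - {x}) t + deg (U - {x}) u + deg (U - {x}) v + deg (U - {x}) w"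
proof -
  have "deg_sum U = deg_sum (U - {x, t, u, v, w}) + 2 * (deg U x + deg (U - {x}) t + deg (U - {x, t}) u
      + deg (U - {x, t, u}) v + deg (U - {x, t, u, v}) w)"
    using deg_sum_remove_list[of U "[x, t, u, v, w]"] U Y
    by (simp add: eval_nat_numeral insert_commute)
  moreover have "deg_sum (U - {x, t, u, v, w}) \<le> 3 * card (U - {x, t, u, v, w})"
    using U free by (intro path5_free_deg_sum) auto
  moreover have "card (U - {x, t, u, v, w}) + 5 = card U"
    using U Y card_Diff_subset[of "{x, t, u, v, w}" U] card_mono[of U "{x, t, u, v, w}"] by simp
  moreover have "deg U x \<le> card U - 1" using U Y by (intro deg_less_card) auto
  moreover have "deg (U - {x, t}) u \<le> deg (U - {x}) u" "deg (U - {x, t, u}) v \<le> deg (U - {x}) v"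
    "deg (U - {x, t, u, v}) w \<le> deg (U - {x}) w"
    using U by (auto intro!: deg_mono)
  ultimately show ?thesis using denseD[OF U(2)] by presburger
qed

lemma tight_min_degree:
  assumes "finite U" "tight U" "v \<in> U"
  shows "3 \<le> deg U v"
proof -
  have "deg_sum (U - {v}) + 4 * card {v} < deg_sum U" using assms unfolding tight_def by blast
  then show ?thesis using deg_sum_remove[OF assms(1,3)] by simp
qed

lemma tight_touch:
  assumes "finite U" "tight U" "S \<subseteq> U" "S \<noteq> {}"
  shows "4 * card S < deg_sum S + 2 * (\<Sum>v\<in>S. deg (U - S) v)"
proof -
  have "deg_sum (U - S) + 4 * card S < deg_sum U" using assms unfolding tight_def by blast
  then show ?thesis using deg_sum_split[OF assms(1,3)] by simp
qed

section \<open>Path-free graphs around a branching vertex\<close>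

text \<open>If \<open>a\<close> and \<open>a'\<close> are not adjacent, their further neighbours
  must coincide in one vertex \<open>y\<close>, else \<open>y a b a' y'\<close> is a path. Degree 4
  then provides a neighbour \<open>c\<close> of \<open>b\<close> off \<open>{a, a', y}\<close>, and
  \<open>c b a y a'\<close> is a path.\<close>

lemma nonleaf_neighbours_adjacent:
  assumes free: "path5_free R" and b: "b \<in> R" "4 \<le> deg R b"
    and a: "a \<in> nbrs R b" "2 \<le> deg R a" and a': "a' \<in> nbrs R b" "2 \<le> deg R a'" "a \<noteq> a'"
  shows "adj a a'"
proof (rule ccontr)
  assume na: "\<not> adj a a'"
  note F = path5_freeD[OF free]
  obtain y where y: "y \<in> R" "adj a y" "y \<noteq> b" using ex_nbrs1[OF a(2), of b] by blast
  obtain y' where y': "y' \<in> R" "adj a' y'" "y' \<noteq> b" using ex_nbrs1[OF a'(2), of b] by blast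
  have ne: "y \<noteq> a'" "y' \<noteq> a" "y \<noteq> a" "y' \<noteq> a'" "a \<noteq> b" "a' \<noteq> b"
    using na y y' a a' by (metis adj_sym adj_irrefl mem_nbrs)+
  have "y = y'"
  proof (rule ccontr)
    assume "y \<noteq> y'"
    show False by (rule F[of y a b a' y']) (use \<open>y \<noteq> y'\<close> y y' a a' b ne in auto)
  qed
  obtain c where c: "c \<in> R" "adj b c" "c \<notin> {a, a', y}" using ex_nbrs3[OF b(2), of a a' y] by blast
  have "c \<noteq> b" using c by (metis adj_irrefl)
  show False by (rule F[of c b a y a']) (use \<open>y = y'\<close> y y' a a' b c ne \<open>c \<noteq> b\<close> in auto)
qed

lemma card_nonleaf_neighbours:
  assumes free: "path5_free R" "finite R" and b: "b \<in> R" "4 \<le> deg R b"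
  shows "card {a \<in> nbrs R b. 2 \<le> deg R a} \<le> 2"
proof (rule ccontr)
  let ?N = "{a \<in> nbrs R b. 2 \<le> deg R a}"
  assume "\<not> card ?N \<le> 2"
  then have "3 \<le> card ?N" by simp
  then obtain T where "T \<subseteq> ?N" "card T = 3" by (meson obtain_subset_with_card_n)
  then obtain p q r where pqr: "p \<in> ?N" "q \<in> ?N" "r \<in> ?N" "p \<noteq> q" "q \<noteq> r" "p \<noteq> r"
    unfolding card_3_iff by blast
  then have e: "adj p q" "adj q r"
    using nonleaf_neighbours_adjacent[OF free(1) b] by auto
  obtain c where c: "c \<in> R" "adj b c" "c \<notin> {p, q, r}" using ex_nbrs3[OF b(2), of p q r] by blast
  have "c \<noteq> b" "p \<noteq> b" "q \<noteq> b" "r \<noteq> b" using c pqr adj_irrefl by auto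
  show False
    by (rule path5_freeD[OF free(1), of c b p q r])
      (use e c pqr b \<open>c \<noteq> b\<close> \<open>p \<noteq> b\<close> \<open>q \<noteq> b\<close> \<open>r \<noteq> b\<close> in auto)
qed

text \<open>With degree only 3, non-adjacent \<open>a\<close> and \<open>a'\<close> are possible:
  the third neighbour of \<open>b\<close> is then their common neighbour \<open>y\<close>, and
  \<open>a\<close>, \<open>y\<close> are two adjacent neighbours of \<open>b\<close>. Once
  \<open>b p q\<close> is a triangle with a further edge \<open>b c\<close>, any edge from
  \<open>p\<close>, \<open>q\<close> or \<open>c\<close> to a new vertex extends to a path, so these
  three see nothing in \<open>R\<close> beyond the four vertices.\<close>

lemma branching_triangle:
  assumes free: "path5_free R" and b: "b \<in> R" "3 \<le> deg R b"
    and a: "a \<in> nbrs R b" "2 \<le> deg R a" and a': "a' \<in> nbrs R b" "2 \<le> deg R a'" "a \<noteq> a'"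
  obtains p q c where "p \<in> nbrs R b" "q \<in> nbrs R b" "c \<in> nbrs R b" "distinct [p, q, c]" "adj p q"
    "nbrs R p \<subseteq> {b, q, c}" "nbrs R q \<subseteq> {b, p, c}" "nbrs R c \<subseteq> {b, p, q}"
proof -
  note F = path5_freeD[OF free]
  have "\<exists>p q. p \<in> nbrs R b \<and> q \<in> nbrs R b \<and> adj p q"
  proof (cases "adj a a'")
    case True
    then show ?thesis using a a' by blast
  next
    case na: False
    obtain y where y: "y \<in> R" "adj a y" "y \<noteq> b" using ex_nbrs1[OF a(2), of b] by blast
    obtain y' where y': "y' \<in> R" "adj a' y'" "y' \<noteq> b" using ex_nbrs1[OF a'(2), of b] by blast
    have ne: "y \<noteq> a'" "y' \<noteq> a" "y \<noteq> a" "y' \<noteq> a'" "a \<noteq> b" "a' \<noteq> b"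
      using na y y' a a' by (metis adj_sym adj_irrefl mem_nbrs)+
    have "y = y'"
    proof (rule ccontr)
      assume "y \<noteq> y'"
      show False by (rule F[of y a b a' y']) (use \<open>y \<noteq> y'\<close> y y' a a' b ne in auto)
    qed
    obtain c where c: "c \<in> R" "adj b c" "c \<notin> {a, a'}" using ex_nbrs2[OF b(2), of a a'] by blast
    have "c \<noteq> b" using c by (metis adj_irrefl)
    have "c = y"
    proof (rule ccontr)
      assume "c \<noteq> y"
      show False
        by (rule F[of c b a y a']) (use \<open>c \<noteq> y\<close> \<open>y = y'\<close> y y' a a' b c ne \<open>c \<noteq> b\<close> in auto)
    qed
    then show ?thesis using a y c by auto
  qed
  then obtain p q where p: "p \<in> R" "adj b p" and q: "q \<in> R" "adj b q" and pq: "adj p q" by auto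
  obtain c where c: "c \<in> R" "adj b c" "c \<notin> {p, q}" using ex_nbrs2[OF b(2), of p q] by blast
  have ne: "p \<noteq> b" "q \<noteq> b" "c \<noteq> b" "p \<noteq> q" "c \<noteq> p" "c \<noteq> q"
    using p q pq c adj_irrefl by auto
  have "nbrs R p \<subseteq> {b, q, c}"
  proof (rule subsetI, rule ccontr)
    fix z assume z: "z \<in> nbrs R p" and "z \<notin> {b, q, c}"
    then show False by (intro F[of c b q p z]) (use z p q c b pq ne adj_irrefl in auto)
  qed
  moreover have "nbrs R q \<subseteq> {b, p, c}"
  proof (rule subsetI, rule ccontr)
    fix z assume z: "z \<in> nbrs R q" and "z \<notin> {b, p, c}"
    then show False by (intro F[of c b p q z]) (use z p q c b pq ne adj_irrefl in auto)
  qed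
  moreover have "nbrs R c \<subseteq> {b, p, q}"
  proof (rule subsetI, rule ccontr)
    fix z assume z: "z \<in> nbrs R c" and "z \<notin> {b, p, q}"
    then show False by (intro F[of z c b p q]) (use z p q c b pq ne adj_irrefl in auto)
  qed
  ultimately show ?thesis
    by (intro that[of p q c]) (use p q c pq ne in auto)
qed

text \<open>Vertices of \<open>X\<close> with three neighbours in \<open>L\<close> have disjoint neighbourhoods there.\<close>

lemma incidence_bound:
  assumes fin: "finite X" "card X = 5" "finite L"
    and pat: "\<And>u v w x y. u \<in> L \<Longrightarrow> v \<in> L \<Longrightarrow> w \<in> L \<Longrightarrow> distinct [u, v, w] \<Longrightarrow> x \<in> X \<Longrightarrow> y \<in> X \<Longrightarrow> x \<noteq> y
      \<Longrightarrow> adj x u \<Longrightarrow> adj x v \<Longrightarrow> adj y v \<Longrightarrow> adj y w \<Longrightarrow> False"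
  shows "(\<Sum>v\<in>L. deg X v) \<le> card L + 8"
proof -
  define B where "B = {x \<in> X. 3 \<le> deg L x}"
  have B: "finite B" "B \<subseteq> X" using fin by (auto simp: B_def)
  have sw: "(\<Sum>v\<in>L. deg X v) = (\<Sum>x\<in>X. deg L x)" using fin by (intro sum_deg_swap)
  also have "\<dots> = (\<Sum>x\<in>X - B. deg L x) + (\<Sum>x\<in>B. deg L x)"
    using sum.subset_diff[OF B(2) fin(1)] by simp
  finally have s: "(\<Sum>v\<in>L. deg X v) = (\<Sum>x\<in>X - B. deg L x) + (\<Sum>x\<in>B. deg L x)" .
  have s1: "(\<Sum>x\<in>X - B. deg L x) \<le> 2 * card (X - B)"
    using sum_bounded_above[of "X - B" "deg L" 2] by (force simp: B_def not_le mult.commute)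
  have "nbrs L x \<inter> nbrs L y = {}" if xy: "x \<in> B" "y \<in> B" "x \<noteq> y" for x y
  proof (rule ccontr)
    assume "nbrs L x \<inter> nbrs L y \<noteq> {}"
    then obtain v where v: "v \<in> L" "adj x v" "adj y v" by auto
    obtain u where u: "u \<in> L" "adj x u" "u \<notin> {v, v}"
      using ex_nbrs2[of L x v v] xy by (auto simp: B_def)
    obtain w where w: "w \<in> L" "adj y w" "w \<notin> {u, v}"
      using ex_nbrs2[of L y u v] xy by (auto simp: B_def)
    show False by (rule pat[of u v w x y]) (use u v w xy B in auto)
  qed
  then have "(\<Sum>x\<in>B. deg L x) = card (\<Union>x\<in>B. nbrs L x)"
    unfolding deg_def using B fin by (subst card_UN_disjoint) auto
  also have "\<dots> \<le> card L" using fin by (intro card_mono) auto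
  finally have s2: "(\<Sum>x\<in>B. deg L x) \<le> card L" .
  have c: "card (X - B) = 5 - card B" using B fin by (simp add: card_Diff_subset)
  \<comment> \<open>If \<open>B\<close> is nonempty, at most four vertices of \<open>X\<close> lie
    outside it, with at most two neighbours each; this is the 8. If \<open>B\<close> is empty, the
    total is at most 10, enough when \<open>L\<close> has two vertices, and at most
    \<open>5 * card L\<close>, enough when it has fewer.\<close>
  show ?thesis
  proof (cases "B = {}")
    case False
    then have "card B \<ge> 1" using B by (simp add: Suc_leI card_gt_0_iff)
    then show ?thesis using s s1 s2 c by simp
  next
    case True
    have "(\<Sum>v\<in>L. deg X v) \<le> card L * 5"
      using sum_bounded_above[of L "deg X" 5] deg_le_card[of X] fin by auto
    then show ?thesis using s s1 s2 c True by (cases "card L \<ge> 2") auto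
  qed
qed

section \<open>A pair with eight common neighbours\<close>

lemma common_neighbours_exist:
  assumes fin: "finite U" and dense: "dense U" and tight: "tight U" and no2: "no_two_paths U"
  shows "\<exists>x\<in>U. \<exists>y\<in>U. x \<noteq> y \<and> 8 \<le> card (nbrs U x \<inter> nbrs U y)"
proof (rule ccontr)
  assume none: "\<not> ?thesis"
  have few: "card (nbrs U x \<inter> nbrs U y) \<le> 7" if "x \<in> U" "y \<in> U" "x \<noteq> y" for x y
  proof (rule ccontr)
    assume "\<not> card (nbrs U x \<inter> nbrs U y) \<le> 7"
    then have "8 \<le> card (nbrs U x \<inter> nbrs U y)" by simp
    then show False using none that by blast
  qed
  \<comment> \<open>This is 23 minus the at most 7 common neighbours. Only the vertex set has to
    carry a path, so any two of its vertices may play the part of \<open>x\<close>,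
    \<open>y\<close>.\<close>
  have cost: "16 \<le> deg (U - {x, y}) u + deg (U - {x, y, u}) v + deg (U - {x, y, u, v}) w"
    if "path5 {x, y, u, v, w}" "{x, y, u, v, w} \<subseteq> U" "distinct [x, y, u, v, w]" for x y u v w
  proof -
    have "path5_free (U - {x, y, u, v, w})" using no2 that unfolding no_two_paths_def by blast
    then show ?thesis
      using path_pair_bound[OF fin dense that(2,3)] few[of x y] that(2,3) by fastforce
  qed
  have "\<not> path5_free U"
    using path5_free_deg_sum[OF fin] denseD[OF dense] by force
  then obtain X where X: "path5 X" "X \<subseteq> U" unfolding path5_free_def by blast
  define R where "R = U - X"
  have XR: "finite X" "finite R" "X \<inter> R = {}" "U = X \<union> R" "card X = 5" "card U = card R + 5"
    using X fin card_path5[OF X(1)] card_Un_disjoint[of X "U - X"]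
    by (auto simp: R_def finite_subset sup.absorb2)
  have free: "path5_free R" using no2 X unfolding no_two_paths_def R_def by blast
  have dgXR: "deg U v = deg X v + deg R v" for v
    unfolding XR(4) using XR by (intro deg_Un)
  have split: "deg W v \<le> card X' + deg R' v"
    if "W \<subseteq> X' \<union> R'" "finite X'" "finite R'" for W X' R' v
  proof -
    have "deg W v \<le> deg (X' \<union> (R' - X')) v" using that by (intro deg_mono) auto
    also have "\<dots> = deg X' v + deg (R' - X') v" using that by (intro deg_Un) auto
    also have "\<dots> \<le> card X' + deg R' v"
      using that by (intro add_mono deg_le_card deg_mono) auto
    finally show ?thesis .
  qed
  \<comment> \<open>\<open>L\<close> sends few edges to \<open>X\<close>, so many edges need many vertices in \<open>H\<close>; but each of those has pendant
    neighbours in \<open>P\<close>, which by minimum degree 3 send more edges from \<open>L\<close> to \<open>X\<close> than allowed.\<close>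
  define L where "L = {v \<in> R. deg R v \<le> 2}"
  define H where "H = {v \<in> R. 3 \<le> deg R v}"
  define P where "P = {v \<in> R. deg R v = 1}"
  have LH: "finite L" "finite H" "finite P" "L \<inter> H = {}" "R = L \<union> H" "P \<subseteq> L"
    using XR by (auto simp: L_def H_def P_def)
  have inc: "(\<Sum>v\<in>L. deg X v) \<le> card L + 8"
  proof (rule incidence_bound)
    fix u v w x y
    assume uvw: "u \<in> L" "v \<in> L" "w \<in> L" "distinct [u, v, w]"
      and xy: "x \<in> X" "y \<in> X" "x \<noteq> y" and e: "adj x u" "adj x v" "adj y v" "adj y w"
    have in_R: "u \<in> R" "v \<in> R" "w \<in> R" "deg R u \<le> 2" "deg R v \<le> 2" "deg R w \<le> 2"
      using uvw by (auto simp: L_def)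
    have dist: "distinct [u, x, v, y, w]" using uvw xy in_R XR(3) by auto
    then have "path5 {u, x, v, y, w}" using e by (intro path5I) auto
    then have "path5 {x, y, u, v, w}" by (simp add: insert_commute)
    moreover have "{x, y, u, v, w} \<subseteq> U" using xy in_R XR(4) by auto
    ultimately have "16 \<le> deg (U - {x, y}) u + deg (U - {x, y, u}) v + deg (U - {x, y, u, v}) w"
      using dist by (intro cost) auto
    \<comment> \<open>Each of \<open>u\<close>, \<open>v\<close>, \<open>w\<close> has at most three
      neighbours in the rest of \<open>X\<close> and two in \<open>R\<close>, so together they pay
      at most 15.\<close>
    moreover have "card (X - {x, y}) = 3" using xy XR by (simp add: card_Diff_subset)
    then have sp: "deg W z \<le> 3 + deg R z" if "W \<subseteq> U - {x, y}" for W z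
      using split[of W "X - {x, y}" R z] that XR by auto
    have "deg (U - {x, y}) u \<le> 3 + deg R u" "deg (U - {x, y, u}) v \<le> 3 + deg R v"
      "deg (U - {x, y, u, v}) w \<le> 3 + deg R w" by (rule sp, blast)+
    ultimately show False using in_R by linarith
  qed (use XR LH in auto)
  \<comment> \<open>Two non-pendant neighbours would produce the vertices \<open>p\<close>,
    \<open>q\<close>, \<open>c\<close> of \<open>branching_triangle\<close>. An edge from them to
    some \<open>x\<close> in \<open>X\<close> closes a path on \<open>{x, b, p, q, c}\<close>, in
    which \<open>p\<close>, \<open>q\<close>, \<open>c\<close> pay at most
    \<open>6 + 5 + 4 = 15\<close>. Without such an edge the three meet at most six edges, three
    inside and three to \<open>b\<close>, too few for \<open>tight\<close>.\<close>
  have pend: "deg R b \<le> card {a \<in> nbrs R b. deg R a = 1} + 1" if b: "b \<in> H" for b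
  proof -
    have bR: "b \<in> R" "3 \<le> deg R b" using b by (auto simp: H_def)
    have "card {a \<in> nbrs R b. 2 \<le> deg R a} \<le> 1"
    proof (rule ccontr)
      let ?N = "{a \<in> nbrs R b. 2 \<le> deg R a}"
      assume "\<not> card ?N \<le> 1"
      then have "2 \<le> card ?N" by simp
      then obtain T where "T \<subseteq> ?N" "card T = 2" by (meson obtain_subset_with_card_n)
      then obtain a a' where "a \<in> ?N" "a' \<in> ?N" "a \<noteq> a'" unfolding card_2_iff by blast
      then obtain p q c where pqc: "p \<in> nbrs R b" "q \<in> nbrs R b" "c \<in> nbrs R b" "distinct [p, q, c]"
        "adj p q" "nbrs R p \<subseteq> {b, q, c}" "nbrs R q \<subseteq> {b, p, c}" "nbrs R c \<subseteq> {b, p, q}"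
        using branching_triangle[OF free bR, of a a'] by auto
      have ne: "p \<noteq> b" "q \<noteq> b" "c \<noteq> b" using pqc adj_irrefl by auto
      have no_path: "\<not> path5 {x, b, p, q, c}" if x: "x \<in> X" for x
      proof
        assume path: "path5 {x, b, p, q, c}"
        have xb: "x \<notin> R" "b \<notin> X" using x bR XR(3) by auto
        have "16 \<le> deg (U - {x, b}) p + deg (U - {x, b, p}) q + deg (U - {x, b, p, q}) c"
          using x bR pqc ne xb XR(4) path by (intro cost) auto
        moreover have cX: "card (X - {x}) = 4" using x XR by simp
        have sub: "nbrs (R - {b}) p \<subseteq> {q, c}" "nbrs (R - {b, p}) q \<subseteq> {c}" "nbrs (R - {b, p, q}) c \<subseteq> {}"
          using pqc(6-8) by (auto simp: nbrs_def)
        have "deg (R - {b}) p \<le> 2" "deg (R - {b, p}) q \<le> 1" "deg (R - {b, p, q}) c \<le> 0"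
          using sub[THEN deg_le_card_superset] pqc(4) by simp_all
        moreover have "deg (U - {x, b}) p \<le> 4 + deg (R - {b}) p"
          using split[of "U - {x, b}" "X - {x}" "R - {b}" p] cX XR by auto
        moreover have "deg (U - {x, b, p}) q \<le> 4 + deg (R - {b, p}) q"
          using split[of "U - {x, b, p}" "X - {x}" "R - {b, p}" q] cX XR by auto
        moreover have "deg (U - {x, b, p, q}) c \<le> 4 + deg (R - {b, p, q}) c"
          using split[of "U - {x, b, p, q}" "X - {x}" "R - {b, p, q}" c] cX XR by auto
        ultimately show False by linarith
      qed
      let ?S = "{p, q, c}"
      have "nbrs X v = {}" if v: "v \<in> ?S" for v
      proof (rule ccontr)
        assume "nbrs X v \<noteq> {}"
        then obtain x where x: "x \<in> X" "adj v x" by auto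
        have xn: "x \<noteq> b" "x \<noteq> p" "x \<noteq> q" "x \<noteq> c" using x bR pqc XR(3) by auto
        consider "v = p" | "v = q" | "v = c" using v by auto
        then have "path5 {x, b, p, q, c}"
        proof cases
          case 1
          then have "path5 {x, p, q, b, c}"
            using x xn pqc ne by (intro path5I) auto
          then show ?thesis by (simp add: insert_commute)
        next
          case 2
          then have "path5 {x, q, p, b, c}"
            using x xn pqc ne by (intro path5I) auto
          then show ?thesis by (simp add: insert_commute)
        next
          case 3
          then have "path5 {x, c, b, p, q}"
            using x xn pqc ne by (intro path5I) auto
          then show ?thesis by (simp add: insert_commute)
        qed
        then show False using no_path x by blast
      qed
      then have "nbrs (U - ?S) v \<subseteq> {b}" if "v \<in> ?S" for v
      proof -
        have "nbrs X v = {}" using that by fact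
        moreover have "nbrs R v \<subseteq> insert b ?S" using that pqc(6-8) by blast
        ultimately show ?thesis unfolding XR(4) nbrs_def by blast
      qed
      then have "deg (U - ?S) v \<le> card {b}" if "v \<in> ?S" for v
        using that by (intro deg_le_card_superset) auto
      then have "deg (U - ?S) v \<le> 1" if "v \<in> ?S" for v
        using that by simp
      then have "(\<Sum>v\<in>?S. deg (U - ?S) v) \<le> of_nat (card ?S) * 1" by (rule sum_bounded_above)
      moreover have "deg_sum ?S \<le> card ?S * (card ?S - 1)" by (intro deg_sum_le_sq) simp
      moreover have "card ?S = 3" using pqc(4) by simp
      moreover have "4 * card ?S < deg_sum ?S + 2 * (\<Sum>v\<in>?S. deg (U - ?S) v)"
        using pqc XR(4) by (intro tight_touch fin tight) auto
      ultimately show False by simp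
    qed
    moreover have "nbrs R b = {a \<in> nbrs R b. deg R a = 1} \<union> {a \<in> nbrs R b. 2 \<le> deg R a}"
    proof -
      have "1 \<le> deg R a" if "a \<in> nbrs R b" for a
      proof -
        have "b \<in> nbrs R a" using that bR by (auto simp: adj_commute)
        then have "nbrs R a \<noteq> {}" by blast
        then show ?thesis using XR(2) by (simp add: deg_def Suc_leI card_gt_0_iff)
      qed
      then show ?thesis by fastforce
    qed
    then have "deg R b \<le> card {a \<in> nbrs R b. deg R a = 1} + card {a \<in> nbrs R b. 2 \<le> deg R a}"
      unfolding deg_def by (metis (no_types, lifting) card_Un_le)
    ultimately show ?thesis by simp
  qed
  have "(\<Sum>b\<in>H. deg R b) \<le> card P + card H"
  proof -
    have "{a \<in> nbrs R b. deg R a = 1} \<inter> {a \<in> nbrs R b'. deg R a = 1} = {}"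
      if "b \<in> H" "b' \<in> H" "b \<noteq> b'" for b b'
    proof (rule ccontr)
      assume "\<not> ?thesis"
      then obtain a where a: "a \<in> R" "adj b a" "adj b' a" "deg R a = 1" by auto
      then have "{b, b'} \<subseteq> nbrs R a" using that a by (auto simp: H_def adj_commute)
      then have "card {b, b'} \<le> deg R a" unfolding deg_def using XR by (intro card_mono) auto
      then show False using a that by simp
    qed
    then have "(\<Sum>b\<in>H. card {a \<in> nbrs R b. deg R a = 1}) = card (\<Union>b\<in>H. {a \<in> nbrs R b. deg R a = 1})"
      using LH XR by (subst card_UN_disjoint) auto
    also have "\<dots> \<le> card P" using LH by (intro card_mono) (auto simp: P_def)
    finally have "(\<Sum>b\<in>H. card {a \<in> nbrs R b. deg R a = 1}) \<le> card P" .
    moreover have "(\<Sum>b\<in>H. deg R b) \<le> (\<Sum>b\<in>H. card {a \<in> nbrs R b. deg R a = 1} + 1)"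
      using pend by (rule sum_mono)
    ultimately show ?thesis unfolding sum.distrib by simp
  qed
  moreover have "3 * card H \<le> (\<Sum>b\<in>H. deg R b)"
    using sum_bounded_below[of H 3 "deg R"] by (auto simp: H_def mult.commute)
  moreover have "(\<Sum>b\<in>H. deg X b) \<le> 5 * card H"
    using sum_bounded_above[of H "deg X" 5] deg_le_card[of X] XR by (auto simp: mult.commute)
  moreover have "3 * card L \<le> (\<Sum>v\<in>L. deg X v) + (\<Sum>v\<in>L. deg R v)"
  proof -
    have "3 \<le> deg X v + deg R v" if "v \<in> L" for v
      using tight_min_degree[OF fin tight, of v] dgXR[of v] that LH XR by auto
    then show ?thesis
      using sum_bounded_below[of L 3 "\<lambda>v. deg X v + deg R v"] by (simp add: sum.distrib mult.commute)
  qed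
  moreover have "(\<Sum>v\<in>L. deg R v) + card P \<le> 2 * card L" "(\<Sum>v\<in>L. deg R v) + 2 * card P \<le> 3 * card L"
  proof -
    have p: "(\<Sum>v\<in>L. if v \<in> P then m else 0) = m * card P" for m :: nat
    proof -
      have "L \<inter> P = P" using LH by auto
      then show ?thesis using LH by (simp add: sum.If_cases mult.commute)
    qed
    have "(\<Sum>v\<in>L. deg R v + (if v \<in> P then 1 else 0)) \<le> card L * 2"
      using sum_bounded_above[of L "\<lambda>v. deg R v + (if v \<in> P then 1 else 0)" 2] by (auto simp: L_def P_def)
    then show "(\<Sum>v\<in>L. deg R v) + card P \<le> 2 * card L" using p[of 1] by (simp add: sum.distrib)
    have "(\<Sum>v\<in>L. deg R v + (if v \<in> P then 2 else 0)) \<le> card L * 3"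
      using sum_bounded_above[of L "\<lambda>v. deg R v + (if v \<in> P then 2 else 0)" 3] by (auto simp: L_def P_def)
    then show "(\<Sum>v\<in>L. deg R v) + 2 * card P \<le> 3 * card L" using p[of 2] by (simp add: sum.distrib)
  qed
  \<comment> \<open>The average of the two bounds of \<open>dense\<close> is
    \<open>5 * card U + 28\<close>. The five vertices of \<open>X\<close> add 25, and at most 20 is
    lost to edges inside \<open>X\<close>, whence 33.\<close>
  moreover have "5 * card L + 5 * card H + 33
    \<le> 2 * (\<Sum>v\<in>L. deg X v) + (\<Sum>v\<in>L. deg R v) + 2 * (\<Sum>b\<in>H. deg X b) + (\<Sum>b\<in>H. deg R b)"
  proof -
    have "deg_sum U = deg_sum R + deg_sum X + 2 * (\<Sum>v\<in>R. deg X v)"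
      using deg_sum_Un[of R X] XR by (simp add: Un_commute Int_commute)
    moreover have "deg_sum X \<le> 20" using deg_sum_le_sq[OF XR(1)] XR(5) by simp
    moreover have "5 * card U + 28 \<le> deg_sum U" using denseD[OF dense] by linarith
    moreover have "card R = card L + card H" using LH by (simp add: card_Un_disjoint)
    moreover have "(\<Sum>v\<in>R. deg X v) = (\<Sum>v\<in>L. deg X v) + (\<Sum>b\<in>H. deg X b)"
      "deg_sum R = (\<Sum>v\<in>L. deg R v) + (\<Sum>b\<in>H. deg R b)"
      unfolding deg_sum_def LH(5) using LH by (simp_all add: sum.union_disjoint)
    ultimately show ?thesis using XR(6) by linarith
  qed
  \<comment> \<open>Write \<open>l\<close>, \<open>h\<close>, \<open>p\<close> for the sizes of
    \<open>L\<close>, \<open>H\<close>, \<open>P\<close> and \<open>d\<close> for the degree sum of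
    \<open>L\<close> into \<open>R\<close>. The edge count gives \<open>3 * l + 17\<close> \<le>
    \<open>d + 6 * h + p\<close>, and \<open>2 * h\<close> \<le> \<open>p\<close>, so with
    \<open>d + 2 * p\<close> \<le> \<open>3 * l\<close> it follows that \<open>17\<close> \<le>
    \<open>2 * p\<close>. Minimum degree 3 and \<open>inc\<close> give \<open>2 * l\<close> \<le>
    \<open>d + 8\<close>, so with \<open>d + p\<close> \<le> \<open>2 * l\<close> also
    \<open>p\<close> \<le> \<open>8\<close>.\<close>
  ultimately show False using inc by linarith
qed

lemma sum_if_mem: "finite S \<Longrightarrow> (\<Sum>v\<in>S. if v \<in> T then 1 else 0 :: nat) = card (S \<inter> T)"
  by (simp add: sum.If_cases)

section \<open>The structure left by the pair when no star is required\<close>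

text \<open>A three-vertex path of \<open>H\<close> that touches \<open>b1\<close> or
  \<open>b2\<close> grows to five vertices through a common neighbour. Two disjoint paths obtained
  around the two vertices of \<open>B\<close> contradict \<open>no_two_paths\<close>, which strips
  \<open>H\<close> down to a star and one edge. The largest set to be avoided has seven vertices, in
  \<open>clash_edges\<close>; this is why eight common neighbours are needed.\<close>

lemma tight_two_paths_extremal:
  assumes fin: "finite U" and dense: "dense U" and tight: "tight U" and no2: "no_two_paths U"
  shows "extremal 0 U"
proof -
  obtain b1 b2 where b12: "b1 \<in> U" "b2 \<in> U" "b1 \<noteq> b2" "8 \<le> card (nbrs U b1 \<inter> nbrs U b2)"
    using common_neighbours_exist[OF assms] by blast
  define W where "W = nbrs U b1 \<inter> nbrs U b2"
  define B where "B = {b1, b2}"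
  define H where "H = U - B"
  have W: "finite W" "8 \<le> card W" "W \<subseteq> H"
    using fin b12 adj_irrefl by (auto simp: W_def H_def B_def)
  have WB: "adj b r" if "r \<in> W" "b \<in> B" for r b
    using that by (auto simp: W_def B_def)
  have HB: "finite H" "finite B" "card B = 2" "H \<inter> B = {}" "U = H \<union> B"
    using fin b12 by (auto simp: H_def B_def)
  then have cardU: "card U = card H + 2" using card_Un_disjoint[of H B] by simp
  have other: "\<exists>b'\<in>B. b' \<noteq> b" if "b \<in> B" for b
    using that b12 by (auto simp: B_def)
  have Wmin: "n \<le> card (W - Z)" if "finite Z" "card Z + n \<le> 8" for Z n
    using that W diff_card_le_card_Diff[of Z W] by linarith
  have clash: False if "path5 Y" "path5 Z" "Y \<subseteq> U" "Z \<subseteq> U" "Y \<inter> Z = {}" for Y Z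
    using no2 that unfolding no_two_paths_def path5_free_def by blast
  have freeH: "path5_free H"
    unfolding path5_free_def
  proof (intro allI impI notI)
    fix Z assume Z: "Z \<subseteq> H" "path5 Z"
    have "3 \<le> card (W - Z)" using Wmin[of Z 3] finite_path5 card_path5 Z by simp
    then obtain T where "T \<subseteq> W - Z" "card T = 3" by (meson obtain_subset_with_card_n)
    then obtain p q r where pqr: "p \<in> W - Z" "q \<in> W - Z" "r \<in> W - Z" "p \<noteq> q" "q \<noteq> r" "p \<noteq> r"
      unfolding card_3_iff by blast
    have "path5 {p, b1, q, b2, r}"
      by (rule path5I) (use pqr b12 WB W HB(4) in \<open>auto simp: B_def\<close>)
    moreover have "{p, b1, q, b2, r} \<inter> Z = {}" using pqr Z HB(4) by (auto simp: B_def)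
    ultimately show False
      using clash[of "{p, b1, q, b2, r}" Z] Z pqr b12 W HB(5) by auto
  qed
  have attach: "path5 {r, b, u, v, w}"
    if "b \<in> B" "r \<in> W" "{u, v, w} \<subseteq> H" "adj b u" "adj u v" "adj v w" "u \<noteq> w" "r \<notin> {u, v, w}" for b r u v w
  proof (rule path5I)
    have "u \<noteq> v" "v \<noteq> w" using that adj_neq by auto
    moreover have "b \<notin> H" using that HB(4) by auto
    ultimately show "distinct [r, b, u, v, w]" using that W(3) by auto
  qed (use that WB in auto)
  have clash_paths: False
    if b: "b \<in> B" "b' \<in> B" "b \<noteq> b'" and in_H: "{u, v, w, u', v', w'} \<subseteq> H"
      and dist: "distinct [u, v, w, u', v', w']"
      and e: "adj b u" "adj u v" "adj v w" "adj b' u'" "adj u' v'" "adj v' w'"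
    for b b' u v w u' v' w'
  proof -
    have "2 \<le> card (W - {u, v, w, u', v', w'})" using dist by (intro Wmin) auto
    then obtain T where "T \<subseteq> W - {u, v, w, u', v', w'}" "card T = 2"
      by (meson obtain_subset_with_card_n)
    then obtain r r' where r: "r \<in> W - {u, v, w, u', v', w'}" "r' \<in> W - {u, v, w, u', v', w'}" "r \<noteq> r'"
      unfolding card_2_iff by blast
    have nH: "b \<notin> H" "b' \<notin> H" and "r \<in> H" "r' \<in> H" using b r HB(4) W(3) by blast+
    have nbrs: "b \<notin> {r, u, v, w, r', u', v', w'}" "b' \<notin> {r, u, v, w, r', u', v', w'}"
      "r' \<noteq> b"
      using nH in_H \<open>r \<in> H\<close> \<open>r' \<in> H\<close> by blast+
    have d: "{r, b, u, v, w} \<inter> {r', b', u', v', w'} = {}" using b(3) dist r nbrs by simp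
    have p1: "path5 {r, b, u, v, w}"
      by (rule attach[OF b(1) _ _ e(1-3)]) (use dist r in_H in simp_all)
    have p2: "path5 {r', b', u', v', w'}"
      by (rule attach[OF b(2) _ _ e(4-6)]) (use dist r in_H in simp_all)
    have sub: "{r, b, u, v, w} \<subseteq> U" "{r', b', u', v', w'} \<subseteq> U"
      using in_H b \<open>r \<in> H\<close> \<open>r' \<in> H\<close> unfolding HB(5) by simp_all
    show False by (rule clash[OF p1 p2 sub d])
  qed
  have clash_edges: False
    if b: "b \<in> B" "b' \<in> B" "b \<noteq> b'" and in_H: "{x, y, z, t, u, v, w} \<subseteq> H"
      and dist: "distinct [x, y, z, t, u, v, w]"
      and e: "adj x y" "adj b x" "adj b z" "adj z t" "adj b' u" "adj u v" "adj v w"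
    for b b' x y z t u v w
  proof -
    have "1 \<le> card (W - {x, y, z, t, u, v, w})" using dist by (intro Wmin) auto
    then have "W - {x, y, z, t, u, v, w} \<noteq> {}" by (metis card.empty not_one_le_zero)
    then obtain r where r: "r \<in> W - {x, y, z, t, u, v, w}" by blast
    have nH: "b \<notin> H" "b' \<notin> H" "r \<in> H" using b r HB(4) W(3) by auto
    have nbrs: "b \<notin> {x, y, z, t, r, u, v, w}" "b' \<notin> {x, y, z, t, r, u, v, w}"
      "r \<noteq> b" using nH in_H by blast+
    have d: "{y, x, b, z, t} \<inter> {r, b', u, v, w} = {}" using b(3) dist r nbrs by simp
    have p1: "path5 {y, x, b, z, t}"
      by (rule path5I) (use dist e nbrs in auto)
    have p2: "path5 {r, b', u, v, w}"
      by (rule attach[OF b(2) _ _ e(5-7)]) (use dist r in_H in simp_all)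
    have sub: "{y, x, b, z, t} \<subseteq> U" "{r, b', u, v, w} \<subseteq> U"
      using in_H b nH unfolding HB(5) by simp_all
    show False by (rule clash[OF p1 p2 sub d])
  qed
  have dgU: "deg U v = deg H v + deg B v" for v
    unfolding HB(5) using HB by (intro deg_Un) auto
  have dgB: "deg B v \<le> 2" for v using deg_le_card[of B v] HB by simp
  have full: "adj b v" if "2 \<le> deg B v" "b \<in> B" for v b
  proof -
    have "nbrs B v = B" using that HB card_subset_eq[of B "nbrs B v"] nbrs_subset[of B v] dgB[of v]
      unfolding deg_def by simp
    then have "b \<in> nbrs B v" using that(2) by simp
    then show ?thesis by (simp add: adj_commute)
  qed
  have mindeg: "3 \<le> deg H v + deg B v" if "v \<in> H" for v
    using tight_min_degree[OF fin tight, of v] that dgU[of v] HB(5) by auto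
  have count: "6 * card H + 2 \<le> deg_sum H + deg_sum B + 2 * (\<Sum>v\<in>H. deg B v)"
    using denseD(1)[OF dense] deg_sum_Un[of H B] HB cardU by simp
  have eeB: "deg_sum B \<le> 2" using deg_sum_le_sq[OF HB(2)] HB(3) by simp
  have sumB: "(\<Sum>v\<in>H. deg B v) \<le> 2 * card H"
    using sum_bounded_above[of H "deg B" 2] dgB by (simp add: mult.commute)
  \<comment> \<open>At most one edge lies inside \<open>B\<close> and at most two run from each
    vertex of \<open>H\<close> to \<open>B\<close>, so \<open>H\<close> itself has at least
    \<open>card H\<close> edges. This will turn out to be an equality.\<close>
  have eeH: "2 * card H \<le> deg_sum H" using count eeB sumB by linarith

  have "\<exists>c\<in>H. 4 \<le> deg H c"
  proof -
    \<comment> \<open>\<open>T\<close> collects the starting vertices of three-vertex paths in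
      \<open>H\<close>. If none of them saw \<open>B\<close>, minimum degree 3 would make
      \<open>T\<close> closed under neighbours, and path-freeness would give it at most
      \<open>3 * card T / 2\<close> edges, fewer than \<open>tight\<close> demands.\<close>
    define T where "T = {u \<in> H. \<exists>v\<in>H. \<exists>w\<in>H. adj u v \<and> adj v w \<and> w \<noteq> u}"
    have "\<exists>v\<in>H. 2 \<le> deg H v"
    proof (rule ccontr)
      assume "\<not> ?thesis"
      then have "deg H v \<le> 1" if "v \<in> H" for v using that by force
      then have "deg_sum H \<le> of_nat (card H) * 1" unfolding deg_sum_def by (rule sum_bounded_above)
      moreover have "card H \<noteq> 0" using W HB card_mono[of H W] by auto
      ultimately show False using eeH by simp
    qed
    then obtain v where v: "v \<in> H" "2 \<le> deg H v" by blast
    obtain u where u: "u \<in> H" "adj v u" using ex_nbrs1[OF v(2), of v] by blast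
    obtain w where w: "w \<in> H" "adj v w" "w \<noteq> u" using ex_nbrs1[OF v(2), of u] by blast
    have "u \<in> T" using u v w adj_sym[OF u(2)] by (auto simp: T_def)
    then have T: "T \<noteq> {}" "T \<subseteq> H" by (auto simp: T_def)
    have "\<exists>u\<in>T. nbrs B u \<noteq> {}"
    proof (rule ccontr)
      assume "\<not> ?thesis"
      then have unatt: "nbrs B u = {}" if "u \<in> T" for u using that by blast
      have "nbrs (U - T) v = {}" if v: "v \<in> T" for v
      proof (rule ccontr)
        assume "nbrs (U - T) v \<noteq> {}"
        then obtain z where "z \<in> nbrs (U - T) v" by blast
        then have z: "z \<in> U - T" "adj v z" by simp_all
        then have "z \<in> H" using unatt[OF v] unfolding HB(5) by auto
        have "2 \<le> deg H v" using mindeg[of v] unatt[OF v] v T(2) by (auto simp: deg_def)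
        then obtain w where "w \<in> H" "adj v w" "w \<noteq> z" using ex_nbrs1[of H v z] by blast
        then have "z \<in> T" using z \<open>z \<in> H\<close> v T(2) adj_sym[OF z(2)] by (auto simp: T_def)
        then show False using z by blast
      qed
      then have "(\<Sum>v\<in>T. deg (U - T) v) = 0" by (simp add: deg_def)
      moreover have "deg_sum T \<le> 3 * card T"
        using freeH T HB by (intro path5_free_deg_sum path5_free_mono[OF freeH]) (auto intro: finite_subset)
      moreover have "4 * card T < deg_sum T + 2 * (\<Sum>v\<in>T. deg (U - T) v)"
        using T HB(5) by (intro tight_touch fin tight) auto
      ultimately show False by simp
    qed
    then obtain b u where "u \<in> T" "b \<in> nbrs B u" by blast
    then have bu: "b \<in> B" "adj u b" "u \<in> T" by simp_all
    then obtain v w where vw: "v \<in> H" "w \<in> H" "adj u v" "adj v w" "w \<noteq> u" "u \<in> H"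
      unfolding T_def by blast
    have "1 \<le> card (W - {u, v, w})"
      by (rule Wmin) (auto simp: card_insert_if)
    then have "W - {u, v, w} \<noteq> {}" by (metis card.empty not_one_le_zero)
    then obtain r where r: "r \<in> W" "r \<notin> {u, v, w}" by blast
    have path: "path5 {r, b, u, v, w}"
      using bu vw r adj_sym[OF bu(2)] by (intro attach) auto
    then have path': "path5 {b, r, u, v, w}" by (simp add: insert_commute)
    have sub: "{b, r, u, v, w} \<subseteq> U" using bu vw r W(3) unfolding HB(5) by auto
    have "distinct [b, r, u, v, w]"
      using card_path5[OF path'] by (auto simp: card_insert_if split: if_splits)
    then have "23 \<le> deg (U - {b}) r + deg (U - {b}) u + deg (U - {b}) v + deg (U - {b}) w"
      using no2 path' sub unfolding no_two_paths_def by (intro path_vertex_bound fin dense) auto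
    \<comment> \<open>Without \<open>b\<close> each of the four vertices has at most one neighbour
      in \<open>B\<close>, so their degrees in \<open>H\<close> add up to at least 19.\<close>
    moreover have "deg (U - {b}) z \<le> deg H z + 1" for z
    proof -
      have "U - {b} = H \<union> (B - {b})" using bu(1) HB by auto
      then have "deg (U - {b}) z = deg H z + deg (B - {b}) z" using HB deg_Un[of H "B - {b}" z] by auto
      moreover have "deg (B - {b}) z \<le> card (B - {b})" using HB by (intro deg_le_card) auto
      ultimately show ?thesis using bu HB by simp
    qed
    then have "deg (U - {b}) r + deg (U - {b}) u + deg (U - {b}) v + deg (U - {b}) w
      \<le> (deg H r + 1) + (deg H u + 1) + (deg H v + 1) + (deg H w + 1)"
      by (intro add_mono)
    ultimately have "4 \<le> deg H r \<or> 4 \<le> deg H u \<or> 4 \<le> deg H v \<or> 4 \<le> deg H w" by linarith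
    then show ?thesis using r vw W(3) by auto
  qed
  then obtain c where c: "c \<in> H" "4 \<le> deg H c" by blast
  define NL where "NL = {a \<in> nbrs H c. 2 \<le> deg H a}"
  have NL: "card NL \<le> 2" "finite NL"
    using card_nonleaf_neighbours[OF freeH HB(1) c] HB by (auto simp: NL_def)
  have "2 \<le> card (nbrs H c - NL)"
    using NL c(2) diff_card_le_card_Diff[of NL "nbrs H c"] unfolding deg_def by linarith
  then obtain T where "T \<subseteq> nbrs H c - NL" "card T = 2" by (meson obtain_subset_with_card_n)
  then obtain l l' where l: "l \<in> nbrs H c - NL" "l' \<in> nbrs H c - NL" "l \<noteq> l'"
    unfolding card_2_iff by blast
  have leaf: "nbrs H a = {c}" "2 \<le> deg B a" if a: "a \<in> nbrs H c - NL" for a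
  proof -
    have "c \<in> nbrs H a" using a c by (auto simp: adj_commute)
    moreover have "deg H a \<le> 1" using a by (auto simp: NL_def)
    ultimately show "nbrs H a = {c}"
      unfolding deg_def using HB card_le_Suc0_iff_eq[of "nbrs H a"] by auto
    show "2 \<le> deg B a" using mindeg[of a] \<open>deg H a \<le> 1\<close> a by auto
  qed
  have lH: "l \<in> H" "l' \<in> H" "adj l c" "adj c l'" "l \<noteq> c" "l' \<noteq> c" "adj c l"
    using l adj_irrefl by (auto simp: adj_commute)
  have bl: "adj b l" if "b \<in> B" for b using full[OF leaf(2)[OF l(1)] that] .
  \<comment> \<open>The path \<open>l c l'\<close> is set aside. Minimum degree 3 joins its two ends
    to both vertices of \<open>B\<close>, so whenever a configuration in \<open>H0\<close> uses one
    vertex of \<open>B\<close>, the other one still carries a path through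
    \<open>l c l'\<close>.\<close>
  define H0 where "H0 = H - {l, c, l'}"
  have H0: "finite H0" "H0 \<subseteq> H" "l \<notin> H0" "l' \<notin> H0" "c \<notin> H0" using HB by (auto simp: H0_def)
  have nbH: "nbrs H v \<subseteq> insert c (nbrs H0 v)" if "v \<in> H0" for v
  proof
    fix z assume z: "z \<in> nbrs H v"
    have "z \<noteq> l"
    proof
      assume "z = l"
      then have "v \<in> nbrs H l" using z that H0 by (auto simp: adj_commute)
      then show False using leaf(1)[OF l(1)] that H0 by auto
    qed
    moreover have "z \<noteq> l'"
    proof
      assume "z = l'"
      then have "v \<in> nbrs H l'" using z that H0 by (auto simp: adj_commute)
      then show False using leaf(1)[OF l(2)] that H0 by auto
    qed
    ultimately show "z \<in> insert c (nbrs H0 v)" using z by (auto simp: H0_def)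
  qed
  have no_P3: "w = u" if uvw: "u \<in> H0" "v \<in> H0" "w \<in> H0" "adj u v" "adj v w" for u v w
  proof (rule ccontr)
    assume "w \<noteq> u"
    \<comment> \<open>Vertices of \<open>T\<close> see neither vertex of \<open>B\<close>, since
      otherwise \<open>clash_paths\<close> applies with \<open>l c l'\<close>. The edges leaving
      \<open>T\<close> end in \<open>c\<close> and start in \<open>NL\<close>, so there are at most
      two. Hence \<open>4 * card T < deg_sum T + 4\<close>, against the bound
      \<open>3 * card T\<close> for four or more vertices and against the complete graph on
      \<open>T\<close> for fewer.\<close>
    define T where "T = {u \<in> H0. \<exists>v\<in>H0. \<exists>w\<in>H0. adj u v \<and> adj v w \<and> w \<noteq> u}"
    have T: "u \<in> T" "T \<subseteq> H0" "finite T" using uvw \<open>w \<noteq> u\<close> H0 by (auto simp: T_def)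
    have unatt: "nbrs B u = {}" if u: "u \<in> T" for u
    proof (rule ccontr)
      assume "nbrs B u \<noteq> {}"
      then obtain b where "b \<in> nbrs B u" by blast
      then have b: "b \<in> B" "adj b u" by (simp_all add: adj_commute)
      obtain b' where b': "b' \<in> B" "b' \<noteq> b" using other b by blast
      obtain v w where "v \<in> H0" "w \<in> H0" "adj u v" "adj v w" "w \<noteq> u" "u \<in> H0"
        using u unfolding T_def by blast
      moreover have "u \<noteq> v" "v \<noteq> w" using calculation adj_neq by auto
      ultimately show False
        by (intro clash_paths[of b b' u v w l c l']) (use b b' bl lH l H0 c in auto)
    qed
    have dT: "2 \<le> deg H0 v" if v: "v \<in> T" for v
    proof -
      have "3 \<le> deg H v" using mindeg[of v] unatt[OF v] v T(2) H0 by (auto simp: deg_def)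
      moreover have "deg H v \<le> card (insert c (nbrs H0 v))"
        using nbH[of v] v T H0 by (intro deg_le_card_superset) auto
      moreover have "card (insert c (nbrs H0 v)) \<le> Suc (deg H0 v)"
        unfolding deg_def by (rule card_insert_le_m1) auto
      ultimately show ?thesis by linarith
    qed
    have closed: "z \<in> T" if vz: "v \<in> T" "z \<in> nbrs H0 v" for v z
    proof -
      obtain w where "w \<in> H0" "adj v w" "w \<noteq> z" using ex_nbrs1[OF dT[OF vz(1)], of z] by blast
      then show ?thesis using vz T(2) by (auto simp: T_def adj_commute)
    qed
    have "deg (U - T) v \<le> (if v \<in> NL then 1 else 0)" if v: "v \<in> T" for v
    proof -
      have sub: "nbrs (U - T) v \<subseteq> {c}"
      proof
        fix z assume z: "z \<in> nbrs (U - T) v"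
        then have "z \<in> nbrs H v" using unatt[OF v] unfolding HB(5) by auto
        then have "z = c \<or> z \<in> nbrs H0 v" using nbH[of v] v T(2) by blast
        then show "z \<in> {c}" using closed[OF v, of z] z by auto
      qed
      show ?thesis
      proof (cases "v \<in> NL")
        case True
        then show ?thesis using deg_le_card_superset[OF sub] by simp
      next
        case False
        have "3 \<le> deg H v" using mindeg[of v] unatt[OF v] v T(2) H0 by (auto simp: deg_def)
        then have "\<not> adj v c" using False v T(2) H0 by (auto simp: NL_def adj_commute)
        then have "nbrs (U - T) v = {}" using sub by auto
        then show ?thesis by (simp add: deg_def)
      qed
    qed
    then have "(\<Sum>v\<in>T. deg (U - T) v) \<le> (\<Sum>v\<in>T. if v \<in> NL then 1 else 0)" by (rule sum_mono)
    also have "\<dots> = card (T \<inter> NL)" using T(3) by (rule sum_if_mem)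
    also have "\<dots> \<le> card NL" using NL by (intro card_mono) auto
    finally have "(\<Sum>v\<in>T. deg (U - T) v) \<le> 2" using NL by linarith
    moreover have "deg_sum T \<le> 3 * card T"
      using T H0 by (intro path5_free_deg_sum path5_free_mono[OF freeH]) auto
    moreover have "deg_sum T \<le> card T * (card T - 1)" using T by (intro deg_sum_le_sq)
    moreover have "4 * card T < deg_sum T + 2 * (\<Sum>v\<in>T. deg (U - T) v)"
      using T H0 unfolding HB(5) by (intro tight_touch[unfolded HB(5)] fin[unfolded HB(5)] tight[unfolded HB(5)]) auto
    moreover have "card T \<noteq> 0" using T by auto
    moreover have "card T = 1 \<or> card T = 2 \<or> card T = 3 \<or> 4 \<le> card T" using \<open>card T \<noteq> 0\<close> by linarith
    ultimately show False by auto
  qed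
  \<comment> \<open>Two edges of \<open>H0\<close> are disjoint by \<open>no_P3\<close>. Each end
    has a neighbour in \<open>B\<close>, and an end not adjacent to \<open>c\<close> sees both
    vertices of \<open>B\<close>. As \<open>NL\<close> has at most two members, some end is not
    adjacent to \<open>c\<close>, so both edges can be hung on a common \<open>b\<close>, which is
    excluded by \<open>clash_edges\<close>.\<close>
  have one_edge: "{x, y} = {z, w}"
    if xy: "x \<in> H0" "y \<in> H0" "adj x y" and zw: "z \<in> H0" "w \<in> H0" "adj z w" for x y z w
  proof (rule ccontr)
    assume ne: "{x, y} \<noteq> {z, w}"
    have dist: "distinct [x, y, z, w]"
    proof -
      have "x \<noteq> y" "z \<noteq> w" using xy zw adj_neq by auto
      moreover have "x \<noteq> z" using ne no_P3[of y x w] xy zw adj_sym[OF xy(3)] by auto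
      moreover have "x \<noteq> w" using ne no_P3[of y x z] xy zw adj_sym[OF xy(3)] adj_sym[OF zw(3)] by auto
      moreover have "y \<noteq> z" using ne no_P3[of x y w] xy zw by auto
      moreover have "y \<noteq> w" using ne no_P3[of x y z] xy zw adj_sym[OF zw(3)] by auto
      ultimately show ?thesis by auto
    qed
    have nbv: "nbrs H u \<subseteq> {c, v}" if "u \<in> H0" "v \<in> H0" "adj u v" for u v
    proof
      fix p assume "p \<in> nbrs H u"
      then have "p = c \<or> p \<in> nbrs H0 u" using nbH[OF that(1)] by blast
      then show "p \<in> {c, v}" using no_P3[of v u p] that adj_sym[OF that(3)] by auto
    qed
    have some: "\<exists>b\<in>B. adj b u" if "u \<in> H0" "v \<in> H0" "adj u v" for u v
    proof -
      have "deg H u \<le> card {c, v}" by (rule deg_le_card_superset[OF nbv[OF that]]) simp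
      also have "\<dots> \<le> 2" by (simp add: card_insert_if)
      finally have "nbrs B u \<noteq> {}" using mindeg[of u] that H0 by (auto simp: deg_def)
      then obtain b where "b \<in> nbrs B u" by blast
      then show ?thesis by (auto simp: adj_commute)
    qed
    have all: "adj b u" if "u \<in> H0" "v \<in> H0" "adj u v" "\<not> adj u c" "b \<in> B" for u v b
    proof -
      have "nbrs H u \<subseteq> {v}" using nbv[OF that(1-3)] that(4) by auto
      then have "deg H u \<le> card {v}" by (rule deg_le_card_superset) simp
      then have "2 \<le> deg B u" using mindeg[of u] that H0 by auto
      then show ?thesis using full that by blast
    qed
    have inNL: "u \<in> NL" if "u \<in> H0" "v \<in> H0" "adj u v" "adj u c" for u v
    proof -
      have "{v, c} \<subseteq> nbrs H u" using that c H0 by auto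
      then have "card {v, c} \<le> deg H u" unfolding deg_def using HB by (intro card_mono) auto
      moreover have "v \<noteq> c" using that H0 by auto
      ultimately show ?thesis using that H0 by (auto simp: NL_def adj_commute)
    qed
    have fin_step: False
      if "b \<in> B" "adj b x'" "adj b z'" "adj x' y'" "adj z' w'" "{x', y', z', w'} \<subseteq> H0" "distinct [x', y', z', w']"
      for b x' y' z' w'
    proof -
      obtain b' where b': "b' \<in> B" "b' \<noteq> b" using other \<open>b \<in> B\<close> by blast
      show False
        by (rule clash_edges[of b b' x' y' z' w' l c l']) (use that b' bl lH l H0 c in auto)
    qed
    note yx = adj_sym[OF xy(3)]
    consider "\<not> adj x c" | "\<not> adj y c" | "adj x c" "adj y c" by blast
    then show False
    proof cases
      case 1
      obtain b where b: "b \<in> B" "adj b z" using some[OF zw] by blast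
      show False using fin_step[of b x z y w] all[OF xy 1 b(1)] b xy zw dist by auto
    next
      case 2
      obtain b where b: "b \<in> B" "adj b z" using some[OF zw] by blast
      show False using fin_step[of b y z x w] all[OF xy(2,1) yx 2 b(1)] b xy zw yx dist by auto
    next
      case 3
      have "\<not> adj z c"
      proof
        assume "adj z c"
        then have "{x, y, z} \<subseteq> NL" using inNL[OF xy 3(1)] inNL[OF xy(2,1) yx 3(2)] inNL[OF zw] by auto
        then have "card {x, y, z} \<le> card NL" using NL by (intro card_mono) auto
        then show False using dist NL by simp
      qed
      obtain b where b: "b \<in> B" "adj b x" using some[OF xy] by blast
      show False
        using fin_step[of b x z y w] all[OF zw \<open>\<not> adj z c\<close> b(1)] b xy zw dist by auto
    qed
  qed
  have eeH': "deg_sum H = deg_sum H0 + 2 * deg H c"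
  proof -
    have "deg_sum H = deg_sum (H - {c}) + 2 * deg H c" using HB c by (intro deg_sum_remove) auto
    moreover have "deg_sum (H - {c}) = deg_sum (H - {c} - {l}) + 2 * deg (H - {c}) l"
      using HB lH by (intro deg_sum_remove) auto
    moreover have "nbrs (H - {c}) l = {}" using leaf(1)[OF l(1)] by auto
    moreover have "deg_sum (H - {c} - {l}) = deg_sum (H - {c} - {l} - {l'}) + 2 * deg (H - {c} - {l}) l'"
      using HB lH l by (intro deg_sum_remove) auto
    moreover have "nbrs (H - {c} - {l}) l' = {}" using leaf(1)[OF l(2)] by auto
    moreover have "H - {c} - {l} - {l'} = H0" by (auto simp: H0_def)
    ultimately show ?thesis by (simp add: deg_def)
  qed
  have dgc: "deg H c \<le> card H - 1" using HB c by (intro deg_less_card) auto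
  have cH: "1 \<le> card H" using c(1) HB(1) card_gt_0_iff[of H] by (auto simp: Suc_le_eq)
  \<comment> \<open>If \<open>H0\<close> had no edge, the degree sum of \<open>H\<close> would be at
    most \<open>2 * (card H - 1)\<close>, below \<open>eeH\<close>.\<close>
  have "\<exists>s\<in>H0. \<exists>t\<in>H0. adj s t"
  proof (rule ccontr)
    assume "\<not> ?thesis"
    then have "nbrs H0 v = {}" if "v \<in> H0" for v using that by auto
    then have "deg_sum H0 = 0" by (simp add: deg_sum_def deg_def)
    then show False using eeH' dgc eeH cH by linarith
  qed
  then obtain s t where st: "s \<in> H0" "t \<in> H0" "adj s t" by blast
  have "s \<noteq> t" using st adj_neq by blast
  have "deg_sum H0 \<le> 2"
  proof -
    have pair: "{s, t} = {v, z}" if v: "v \<in> H0" and z: "z \<in> nbrs H0 v" for v z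
    proof -
      have "z \<in> H0" "adj v z" using z by simp_all
      then show ?thesis by (rule one_edge[OF st v])
    qed
    have "deg H0 v \<le> (if v \<in> {s, t} then 1 else 0)" if v: "v \<in> H0" for v
    proof (cases "v \<in> {s, t}")
      case True
      have "z = (if v = s then t else s)" if "z \<in> nbrs H0 v" for z
        using pair[OF v that] \<open>s \<noteq> t\<close> by (metis doubleton_eq_iff)
      then have "nbrs H0 v \<subseteq> {if v = s then t else s}" by blast
      then have "deg H0 v \<le> card {if v = s then t else s}" by (rule deg_le_card_superset) simp
      then show ?thesis using True by simp
    next
      case False
      then have "nbrs H0 v = {}" using pair[OF v] by blast
      then show ?thesis using False by (simp add: deg_def)
    qed
    then have "deg_sum H0 \<le> (\<Sum>v\<in>H0. if v \<in> {s, t} then 1 else 0)" unfolding deg_sum_def by (rule sum_mono)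
    also have "\<dots> = card (H0 \<inter> {s, t})" using H0(1) by (rule sum_if_mem)
    also have "\<dots> \<le> card {s, t}" by (intro card_mono) auto
    finally show ?thesis using \<open>s \<noteq> t\<close> by simp
  qed
  \<comment> \<open>The upper bounds on the pieces add up exactly to the lower bound
    \<open>count\<close>, so each of them is attained; this yields all remaining
    adjacencies.\<close>
  then have eqs: "deg H c = card H - 1" "deg_sum B = 2" "(\<Sum>v\<in>H. deg B v) = 2 * card H"
    using eeH' dgc count eeB sumB cH by linarith+
  have adj_c: "adj c v" if "v \<in> H" "v \<noteq> c" for v
  proof -
    have "nbrs H c \<subseteq> H - {c}" using adj_irrefl by auto
    moreover have "card (nbrs H c) = card (H - {c})" using eqs(1) HB c by (simp add: deg_def)
    ultimately have "nbrs H c = H - {c}" using HB by (intro card_subset_eq) auto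
    then show ?thesis using that by (metis Diff_iff empty_iff insert_iff mem_nbrs)
  qed
  have adj_B: "adj b v" if "v \<in> H" "b \<in> B" for v b
  proof -
    have "deg B v = 2"
    proof (rule ccontr)
      assume "deg B v \<noteq> 2"
      then have "deg B v < 2" using dgB[of v] by linarith
      then have "(\<Sum>v\<in>H. deg B v) < (\<Sum>v\<in>H. 2)"
        using that HB dgB by (intro sum_strict_mono_ex1) auto
      then show False using eqs(3) by simp
    qed
    then show ?thesis using full that by simp
  qed
  have "adj b1 b2"
  proof (rule ccontr)
    assume "\<not> adj b1 b2"
    then have "nbrs B b1 = {}" "nbrs B b2 = {}" using adj_irrefl adj_commute[of b1 b2] by (auto simp: B_def)
    then have "deg_sum B = 0" using b12 by (simp add: deg_sum_def deg_def B_def)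
    then show False using eqs(2) by simp
  qed
  have core: "adj u v \<longleftrightarrow> u \<noteq> v \<and> (u \<in> {b1, b2, c} \<or> v \<in> {b1, b2, c} \<or> {u, v} = {s, t})"
    if uv: "u \<in> U" "v \<in> U" for u v
  proof
    assume "adj u v"
    then have "u \<noteq> v" by (rule adj_neq)
    moreover have "{u, v} = {s, t}" if nA: "u \<notin> {b1, b2, c}" "v \<notin> {b1, b2, c}"
    proof -
      have uvH: "u \<in> H" "v \<in> H" using uv nA unfolding HB(5) B_def by auto
      have in_H0: "x \<in> H0" if "x \<in> H" "y \<in> H" "adj x y" "x \<noteq> c" "y \<noteq> c" for x y
      proof -
        have "y \<in> nbrs H x" using that by simp
        then have "nbrs H x \<noteq> {c}" using that by blast
        then have "x \<noteq> l" "x \<noteq> l'" using leaf(1)[OF l(1)] leaf(1)[OF l(2)] by blast+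
        then show ?thesis using that by (simp add: H0_def)
      qed
      have "u \<in> H0" "v \<in> H0"
        using in_H0[OF uvH \<open>adj u v\<close>] in_H0[OF uvH(2,1) adj_sym[OF \<open>adj u v\<close>]] nA by simp_all
      then show ?thesis using one_edge[OF _ _ \<open>adj u v\<close> st] by simp
    qed
    ultimately show "u \<noteq> v \<and> (u \<in> {b1, b2, c} \<or> v \<in> {b1, b2, c} \<or> {u, v} = {s, t})" by blast
  next
    assume r: "u \<noteq> v \<and> (u \<in> {b1, b2, c} \<or> v \<in> {b1, b2, c} \<or> {u, v} = {s, t})"
    have A: "adj x y" if "x \<in> {b1, b2, c}" "y \<in> U" "x \<noteq> y" for x y
    proof (cases "y \<in> H")
      case True
      then show ?thesis using that adj_c[of y] adj_B[of y x] by (auto simp: B_def)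
    next
      case False
      then have y: "y \<in> B" using that(2) HB(5) by blast
      show ?thesis
      proof (cases "x = c")
        case True
        then show ?thesis using adj_sym[OF adj_B[OF c(1) y]] by simp
      next
        case False
        then show ?thesis
          using that y \<open>adj b1 b2\<close> adj_sym[OF \<open>adj b1 b2\<close>] by (auto simp: B_def)
      qed
    qed
    consider "u \<in> {b1, b2, c}" | "v \<in> {b1, b2, c}" | "{u, v} = {s, t}" using r by blast
    then show "adj u v"
    proof cases
      case 1
      then show ?thesis using A r uv by blast
    next
      case 2
      then show ?thesis using A[of v u] r uv adj_sym by blast
    next
      case 3
      then show ?thesis using st adj_sym[OF st(3)] by (auto simp: doubleton_eq_iff)
    qed
  qed
  have "b1 \<noteq> c" "b2 \<noteq> c" using c HB(4) by (auto simp: B_def)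
  then have "card {b1, b2, c} = 0 + 3" using b12(3) by simp
  moreover have "{b1, b2, c} \<subseteq> U" "s \<in> U - {b1, b2, c}" "t \<in> U - {b1, b2, c}"
    using b12 c HB(4) st H0 unfolding HB(5) B_def by auto
  moreover have "\<forall>u\<in>U. \<forall>v\<in>U. adj u v
      \<longleftrightarrow> u \<noteq> v \<and> (u \<in> {b1, b2, c} \<or> v \<in> {b1, b2, c} \<or> {u, v} = {s, t})"
    by (intro ballI core)
  ultimately have "{b1, b2, c} \<subseteq> U \<and> card {b1, b2, c} = 0 + 3 \<and> s \<in> U - {b1, b2, c}
    \<and> t \<in> U - {b1, b2, c} \<and> s \<noteq> t \<and> (\<forall>u\<in>U. \<forall>v\<in>U. adj u v
      \<longleftrightarrow> u \<noteq> v \<and> (u \<in> {b1, b2, c} \<or> v \<in> {b1, b2, c} \<or> {u, v} = {s, t}))"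
    using \<open>s \<noteq> t\<close> by (intro conjI)
  then show ?thesis unfolding extremal_def by (intro exI)
qed

subsection \<open>Extremal structure and packings\<close>

text \<open>In doubled counts, \<open>(k + 3) * (k + 2)\<close> comes from inside \<open>A\<close>,
  \<open>2 * (k + 3) * (n - k - 3)\<close> from edges leaving \<open>A\<close>, and 2 from the edge
  \<open>s t\<close>, where \<open>n\<close> is the order. The equation is arranged to avoid
  subtraction.\<close>

lemma deg_sum_extremal:
  assumes fin: "finite U" and ext: "extremal k U"
  shows "deg_sum U + (k + 3) * (k + 4) = 2 * (k + 3) * card U + 2" "k + 5 \<le> card U"
proof -
  obtain A s t where A: "A \<subseteq> U" "card A = k + 3" "s \<in> U - A" "t \<in> U - A" "s \<noteq> t"
    and e: "\<forall>u\<in>U. \<forall>v\<in>U. adj u v \<longleftrightarrow> u \<noteq> v \<and> (u \<in> A \<or> v \<in> A \<or> {u, v} = {s, t})"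
    using ext unfolding extremal_def by blast
  have finA: "finite A" using A fin finite_subset by blast
  have "card {s, t} \<le> card (U - A)" using A fin by (intro card_mono) auto
  then show n: "k + 5 \<le> card U"
    using A fin finA card_mono[OF fin A(1)] by (simp add: card_Diff_subset)
  have eA: "adj v x \<longleftrightarrow> x \<noteq> v" if "v \<in> A" "x \<in> U" for v x
    using e A(1) that by blast
  have "deg A v = k + 2" if "v \<in> A" for v
  proof -
    have "nbrs A v = A - {v}" using eA[OF that] A(1) by (auto simp: nbrs_def)
    then show ?thesis using that A finA by (simp add: deg_def)
  qed
  then have 1: "deg_sum A = (k + 3) * (k + 2)" using A by (simp add: deg_sum_def)
  have "deg (U - A) v = card U - (k + 3)" if "v \<in> A" for v
  proof -
    have "nbrs (U - A) v = U - A" using eA[OF that] that by (auto simp: nbrs_def)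
    then show ?thesis using A finA by (simp add: deg_def card_Diff_subset)
  qed
  then have 2: "(\<Sum>v\<in>A. deg (U - A) v) = (k + 3) * (card U - (k + 3))" using A by simp
  have "deg (U - A) v = (if v \<in> {s, t} then 1 else 0)" if "v \<in> U - A" for v
  proof -
    have "nbrs (U - A) v = (if v = s then {t} else if v = t then {s} else {})"
      using that A e by (auto simp: doubleton_eq_iff)
    then show ?thesis by (simp add: deg_def)
  qed
  then have "deg_sum (U - A) = (\<Sum>v\<in>U - A. if v \<in> {s, t} then 1 else 0)" by (simp add: deg_sum_def)
  also have "\<dots> = card ((U - A) \<inter> {s, t})" using fin by (intro sum_if_mem) simp
  also have "(U - A) \<inter> {s, t} = {s, t}" using A by auto
  finally have 3: "deg_sum (U - A) = 2" using A by simp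
  obtain m where m: "card U = m + (k + 3)" using n le_Suc_ex[of "k + 3" "card U"] by (auto simp: add.commute)
  have "deg_sum U = (k + 3) * (k + 2) + 2 + 2 * ((k + 3) * m)"
    using deg_sum_split[OF fin A(1)] 1 2 3 m by simp
  then show "deg_sum U + (k + 3) * (k + 4) = 2 * (k + 3) * card U + 2"
    unfolding m by (simp add: algebra_simps)
qed

text \<open>A deletion at a cost of at most two edges per vertex makes the first bound of
  \<open>dense\<close> strict. By induction the smaller graph is extremal, where this bound is an
  equality. Hence \<open>U\<close> is already \<open>tight\<close>.\<close>

lemma two_paths_extremal:
  assumes "finite U" "dense U" "no_two_paths U"
  shows "extremal 0 U"
  using assms
proof (induction "card U" arbitrary: U rule: less_induct)
  case less
  show ?case
  proof (cases "tight U")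
    case True
    then show ?thesis using less.prems by (intro tight_two_paths_extremal)
  next
    case False
    then obtain S where S: "S \<subseteq> U" "S \<noteq> {}" "deg_sum U \<le> deg_sum (U - S) + 4 * card S"
      unfolding tight_def by (auto simp: not_less)
    have finS: "finite S" using S less.prems finite_subset by blast
    have c: "card U = card (U - S) + card S" "0 < card S"
      using S finS less.prems card_mono[of U S] by (auto simp: card_Diff_subset card_gt_0_iff)
    have strict: "6 * card (U - S) < deg_sum (U - S) + 10"
      using denseD(1)[OF less.prems(2)] S(3) c by linarith
    have "dense (U - S)"
      using denseD[OF less.prems(2)] S(3) c unfolding dense_def by linarith
    moreover have "no_two_paths (U - S)"
      unfolding no_two_paths_def
    proof (intro allI impI)
      fix Y assume "Y \<subseteq> U - S" "path5 Y"
      then have "path5_free (U - Y)" using less.prems(3) unfolding no_two_paths_def by blast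
      then show "path5_free (U - S - Y)" by (rule path5_free_mono) auto
    qed
    ultimately have "extremal 0 (U - S)" using less.prems c by (intro less.hyps) auto
    then have "deg_sum (U - S) + 12 = 6 * card (U - S) + 2"
      using deg_sum_extremal(1)[of "U - S" 0] less.prems by simp
    then show ?thesis using strict by linarith
  qed
qed

lemma packs_0: "packs 0 U \<longleftrightarrow> \<not> no_two_paths U"
proof
  assume "packs 0 U"
  then obtain Y1 Y2 F where Y: "packing 0 Y1 Y2 F" "Y1 \<union> Y2 \<union> \<Union>F \<subseteq> U"
    unfolding packs_def by blast
  then have "Y2 \<subseteq> U - Y1" "Y1 \<subseteq> U" using packingD(3)[OF Y(1)] by blast+
  then show "\<not> no_two_paths U"
    using packingD(1,2)[OF Y(1)] unfolding no_two_paths_def path5_free_def by blast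
next
  assume "\<not> no_two_paths U"
  then obtain Y1 Y2 where "path5 Y1" "path5 Y2" "Y1 \<subseteq> U" "Y2 \<subseteq> U - Y1"
    unfolding no_two_paths_def path5_free_def by blast
  then show "packs 0 U"
    by (intro packsI[of 0 Y1 Y2 "{}"]) (auto simp: packing_def)
qed

section \<open>Changing a packing by one star\<close>

lemma card_packing:
  assumes "packing k Y1 Y2 F"
  shows "card (\<Union>F) = 5 * k" "card (Y1 \<union> Y2 \<union> \<Union>F) = 10 + 5 * k" "finite (Y1 \<union> Y2 \<union> \<Union>F)"
proof -
  note Y = packingD[OF assms]
  have finF: "finite (\<Union>F)" using Y finite_star4 by blast
  have "card (\<Union>F) = sum card F" using Y finite_star4 by (intro card_Union_disjoint) auto
  also have "\<dots> = 5 * card F" using Y card_star4 by simp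
  finally show c: "card (\<Union>F) = 5 * k" using Y by simp
  show "finite (Y1 \<union> Y2 \<union> \<Union>F)" using finF Y finite_path5 by simp
  have "card (Y1 \<union> Y2 \<union> \<Union>F) = card (Y1 \<union> Y2) + card (\<Union>F)"
    using Y finF finite_path5 by (intro card_Un_disjoint) auto
  also have "card (Y1 \<union> Y2) = card Y1 + card Y2"
    using Y finite_path5 by (intro card_Un_disjoint) auto
  finally show "card (Y1 \<union> Y2 \<union> \<Union>F) = 10 + 5 * k" using c Y(1,2) card_path5 by simp
qed

lemma packing_insert:
  assumes Y: "packing k Y1 Y2 F" and Z: "star4 Z" "Z \<inter> (Y1 \<union> Y2 \<union> \<Union>F) = {}"
  shows "packing (Suc k) Y1 Y2 (insert Z F)"
proof -
  have "Z \<noteq> {}" using card_star4[OF Z(1)] by auto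
  then have "Z \<notin> F" using Z(2) by blast
  moreover have "pairwise disjnt (insert Z F)"
    using packingD(7)[OF Y] Z(2) unfolding pairwise_insert disjnt_def by blast
  moreover have "(Y1 \<union> Y2) \<inter> \<Union>(insert Z F) = {}"
    using packingD(8)[OF Y] Z(2) by blast
  ultimately show ?thesis
    using packingD[OF Y] Z(1) unfolding packing_def by simp
qed

lemma packing_remove:
  assumes Y: "packing (Suc k) Y1 Y2 F" and Z: "Z \<in> F"
  shows "packing k Y1 Y2 (F - {Z})" "Z \<inter> (Y1 \<union> Y2 \<union> \<Union>(F - {Z})) = {}"
proof -
  show "Z \<inter> (Y1 \<union> Y2 \<union> \<Union>(F - {Z})) = {}"
    using packingD(7,8)[OF Y] Z unfolding pairwise_def disjnt_def by blast
  have "pairwise disjnt (F - {Z})" using packingD(7)[OF Y] by (rule pairwise_subset) blast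
  moreover have "(Y1 \<union> Y2) \<inter> \<Union>(F - {Z}) = {}" using packingD(8)[OF Y] by blast
  ultimately show "packing k Y1 Y2 (F - {Z})"
    using packingD[OF Y] Z unfolding packing_def by simp
qed

lemma packs_extend:
  assumes "packs k (U - Z)" "star4 Z" "Z \<subseteq> U"
  shows "packs (Suc k) U"
proof -
  obtain Y1 Y2 F where Y: "packing k Y1 Y2 F" "Y1 \<union> Y2 \<union> \<Union>F \<subseteq> U - Z"
    using assms(1) unfolding packs_def by blast
  then have "packing (Suc k) Y1 Y2 (insert Z F)" using assms(2) by (intro packing_insert) auto
  then show ?thesis by (rule packsI) (use Y(2) assms(3) in auto)
qed

lemma star4I: "c \<notin> L \<Longrightarrow> card L = 4 \<Longrightarrow> (\<And>l. l \<in> L \<Longrightarrow> adj c l) \<Longrightarrow> star4 (insert c L)"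
  unfolding star4_def by blast

lemma ex_star4:
  assumes "4 + card X \<le> deg S v" "finite X"
  shows "\<exists>L. L \<subseteq> S - X \<and> card L = 4 \<and> star4 (insert v L) \<and> v \<notin> L"
proof -
  have "4 \<le> card (nbrs S v - X)"
    using assms diff_card_le_card_Diff[of X "nbrs S v"] unfolding deg_def by linarith
  then obtain L where L: "L \<subseteq> nbrs S v - X" "card L = 4" by (meson obtain_subset_with_card_n)
  then have "L \<subseteq> S - X" "v \<notin> L" "\<forall>l\<in>L. adj v l" using adj_irrefl by (auto simp: nbrs_def)
  then show ?thesis using star4I[of v L] L(2) by blast
qed

section \<open>Graphs without a vertex of large degree\<close>

text \<open>The terms are, in doubled counts, the complete graph on the \<open>5 * k + 10\<close>
  vertices of \<open>W\<close>, the factor 3 for the vertices outside, and twice the edges leaving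
  \<open>W\<close>: at most \<open>15 * k + 47\<close> from each path and \<open>5 * k + 35\<close>
  from each of the \<open>k\<close> stars.\<close>

lemma bounded_degree_cost:
  assumes fin: "finite U" and Delta: "\<And>v. v \<in> U \<Longrightarrow> deg U v \<le> 5 * k + 13"
    and nopack: "\<not> packs (Suc k) U" and pack: "packs k U"
  shows "deg_sum U + 3 * (5 * k + 10) \<le> (5 * k + 10) * (5 * k + 9) + 3 * card U
    + 2 * (30 * k + 94 + k * (5 * k + 35))"
proof -
  obtain Y1 Y2 F where P: "packing k Y1 Y2 F" "Y1 \<union> Y2 \<union> \<Union>F \<subseteq> U"
    using pack unfolding packs_def by blast
  note Y = packingD[OF P(1)]
  define W where "W = Y1 \<union> Y2 \<union> \<Union>F"
  define R where "R = U - W"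
  have W: "finite W" "card W = 5 * k + 10" "W \<subseteq> U"
    using card_packing[OF P(1)] P(2) by (auto simp: W_def)
  have R: "finite R" "R \<inter> W = {}" "R \<subseteq> U" using fin by (auto simp: R_def)
  have cU: "card U = card R + (5 * k + 10)"
    using W card_Diff_subset[of W U] card_mono[OF fin W(3)] by (simp add: R_def)
  have noR: "\<not> star4 Z" if Z: "Z \<subseteq> R" for Z
  proof
    assume s: "star4 Z"
    have "Y1 \<union> Y2 \<union> \<Union>F \<subseteq> U - Z" using P(2) Z R(2) unfolding W_def by blast
    then have "packs k (U - Z)" by (rule packsI[OF P(1)])
    then show False using nopack packs_extend[OF _ s] Z R(3) by blast
  qed
  have "deg R v \<le> 3" if v: "v \<in> R" for v
  proof (rule ccontr)
    assume "\<not> deg R v \<le> 3"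
    then obtain L where L: "L \<subseteq> R - {}" "star4 (insert v L)"
      using ex_star4[of "{}" R v] by auto
    then have "insert v L \<subseteq> R" using v by blast
    then show False using noR L(2) by blast
  qed
  then have eeR: "deg_sum R \<le> 3 * card R"
    unfolding deg_sum_def using sum_bounded_above[of R "deg R" 3] by (simp add: mult.commute)
  have dgR: "deg R v \<le> 5 * k + 13" if "v \<in> W" for v
    using Delta[of v] deg_mono[of R U v] that W R fin by force
  have path_cost: "(\<Sum>v\<in>Y. deg R v) \<le> 15 * k + 47"
    if Ys: "packing k Y Y' F" "Y \<union> Y' \<union> \<Union>F = W" for Y Y'
  proof -
    note Yd = packingD[OF Ys(1)]
    obtain a b c d e where p: "distinct [a, b, c, d, e]" "adj a b" "adj b c" "adj c d" "adj d e"
      "Y = {a, b, c, d, e}"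
      using Yd(1) unfolding path5_def by blast
    \<comment> \<open>Otherwise \<open>x\<close> centres a star outside \<open>W\<close>, and an outside neighbour of \<open>y\<close> replaces \<open>x\<close> in the path.\<close>
    have two: "deg R x + deg R y \<le> 5 * k + 17"
      if xy: "{x, y, z, u, v} = Y" "distinct [x, y, z, u, v]" "adj y z" "adj z u" "adj u v" for x y z u v
    proof (rule ccontr)
      assume big: "\<not> ?thesis"
      have in_W: "x \<in> W" "y \<in> W" using xy(1) Ys(2) by auto
      have "deg R y \<noteq> 0" "5 \<le> deg R x" using big dgR[OF in_W(1)] dgR[OF in_W(2)] by linarith+
      then have "nbrs R y \<noteq> {}" by (auto simp: deg_def)
      then obtain r where "r \<in> nbrs R y" by blast
      then have r: "r \<in> R" "adj y r" by simp_all
      obtain L where L: "L \<subseteq> R - {r}" "star4 (insert x L)" "x \<notin> L"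
        using ex_star4[of "{r}" R x] \<open>5 \<le> deg R x\<close> by auto
      have "r \<notin> W" using r R by auto
      then have rn: "r \<notin> Y" "r \<notin> Y'" "r \<notin> \<Union>F" using Ys(2) by auto
      have sY: "{y, z, u, v} \<subseteq> Y" "x \<in> Y" using xy(1) by auto
      have "r \<notin> {y, z, u, v}" using rn(1) sY(1) by blast
      then have "distinct [r, y, z, u, v]" using xy(2) by simp
      then have "path5 {r, y, z, u, v}" by (rule path5I) (use r xy(3-5) in simp_all)
      moreover have "{r, y, z, u, v} \<inter> Y' = {}" using sY(1) rn(2) Yd(3) by blast
      moreover have "({r, y, z, u, v} \<union> Y') \<inter> \<Union>F = {}" using sY(1) rn(3) Yd(8) by blast
      ultimately have "packing k {r, y, z, u, v} Y' F"
        unfolding packing_def using Yd(2,4-7) by (intro conjI)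
      moreover have "{r, y, z, u, v} \<union> Y' \<union> \<Union>F \<subseteq> U - insert x L"
      proof -
        have 1: "insert r W \<subseteq> U - L" using L(1) R W(3) r(1) by blast
        have "x \<noteq> r" using in_W \<open>r \<notin> W\<close> by blast
        then have 2: "x \<notin> {r, y, z, u, v}" using xy(2) by simp
        have 3: "x \<notin> Y' \<union> \<Union>F" using sY(2) Yd(3,8) by blast
        have "{r, y, z, u, v} \<subseteq> insert r W" using sY(1) Ys(2) by blast
        moreover have "Y' \<union> \<Union>F \<subseteq> insert r W" using Ys(2) by blast
        ultimately have "{r, y, z, u, v} \<union> Y' \<union> \<Union>F \<subseteq> U - L"
          using 1 by (meson Un_least Un_upper1 Un_upper2 subset_trans)
        moreover have "x \<notin> {r, y, z, u, v} \<union> Y' \<union> \<Union>F"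
          using 2 3 by (simp only: Un_iff de_Morgan_disj simp_thms)
        ultimately show ?thesis by (simp only: subset_Diff_insert simp_thms)
      qed
      ultimately have "packs k (U - insert x L)" by (rule packsI)
      moreover have "insert x L \<subseteq> U" using L R in_W W by auto
      ultimately show False using packs_extend[of k U "insert x L"] L nopack by blast
    qed
    \<comment> \<open>The two end edges account for \<open>5 * k + 17\<close> each, the middle
      vertex for \<open>5 * k + 13\<close>.\<close>
    have "(\<Sum>v\<in>Y. deg R v) = deg R a + deg R b + deg R c + deg R d + deg R e"
      unfolding p(6) using p(1) by simp
    moreover have "deg R a + deg R b \<le> 5 * k + 17"
      by (rule two[of a b c d e]) (use p in auto)
    moreover have "deg R e + deg R d \<le> 5 * k + 17"
      by (rule two[of e d c b a]) (use p(1,6) p(2-4)[THEN adj_sym] in auto)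
    moreover have "deg R c \<le> 5 * k + 13" using dgR[of c] p(6) Ys(2) by auto
    ultimately show ?thesis by linarith
  qed
  have star_cost: "(\<Sum>v\<in>Z. deg R v) \<le> 5 * k + 35" if Z: "Z \<in> F" for Z
  proof -
    have sZ: "star4 Z" "card Z = 5" "finite Z" "Z \<subseteq> W"
      using Z Y card_star4 finite_star4 by (auto simp: W_def)
    \<comment> \<open>After \<open>y\<close> has taken four outside neighbours, eight leave
      \<open>x\<close> four others. The stars at \<open>x\<close> and \<open>y\<close> replace
      \<open>Z\<close>, a gain of one star.\<close>
    have two: False if xy: "x \<in> Z" "y \<in> Z" "x \<noteq> y" "8 \<le> deg R x" "4 \<le> deg R y" for x y
    proof -
      obtain L where L: "L \<subseteq> R - {}" "card L = 4" "star4 (insert y L)"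
        using ex_star4[of "{}" R y] xy(5) by auto
      have "finite L" using L(1) R(1) finite_subset by auto
      then obtain M where M: "M \<subseteq> R - L" "card M = 4" "star4 (insert x M)"
        using ex_star4[of L R x] xy(4) L(2) by auto
      have disj: "insert x M \<inter> insert y L = {}"
        using L(1) M(1) xy sZ(4) R(2) by blast
      obtain k' where k': "k = Suc k'" using Y(4,5) Z by (cases k) auto
      note rem = packing_remove[OF P(1)[unfolded k'] Z]
      have sub: "Y1 \<union> Y2 \<union> \<Union>(F - {Z}) \<subseteq> W - Z" using rem(2) unfolding W_def by blast
      then have "insert x M \<inter> (Y1 \<union> Y2 \<union> \<Union>(F - {Z})) = {}" using M(1) xy(1) R(2) by blast
      then have "packing k Y1 Y2 (insert (insert x M) (F - {Z}))"
        unfolding k' by (intro packing_insert rem(1) M(3))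
      moreover have "Y1 \<union> Y2 \<union> \<Union>(insert (insert x M) (F - {Z})) \<subseteq> U - insert y L"
      proof -
        have "insert x M \<subseteq> U - insert y L" using M(1) xy(1) sZ(4) W(3) R(3) disj by blast
        moreover have "W - Z \<subseteq> U - insert y L" using L(1) W(3) R(2) xy(2) by blast
        ultimately show ?thesis using sub by blast
      qed
      ultimately have "packs k (U - insert y L)" by (rule packsI)
      moreover have "insert y L \<subseteq> U" using L R xy sZ W by auto
      ultimately show False using packs_extend[of k U "insert y L"] L nopack by blast
    qed
    \<comment> \<open>One vertex with at least eight outside neighbours forces at most three on each
      of the others, in total \<open>5 * k + 25\<close>; if there is none, the total is at most
      \<open>5 * 7\<close>. The claimed bound covers both.\<close>
    show ?thesis
    proof (cases "\<exists>x\<in>Z. 8 \<le> deg R x")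
      case True
      then obtain x where x: "x \<in> Z" "8 \<le> deg R x" by blast
      have "(\<Sum>v\<in>Z. deg R v) = deg R x + (\<Sum>v\<in>Z - {x}. deg R v)"
        using sZ x by (intro sum.remove)
      moreover have "deg R y \<le> 3" if "y \<in> Z - {x}" for y
        using two[of x y] that x by force
      then have "(\<Sum>v\<in>Z - {x}. deg R v) \<le> of_nat (card (Z - {x})) * 3" by (rule sum_bounded_above)
      moreover have "card (Z - {x}) = 4" using sZ x by simp
      moreover have "deg R x \<le> 5 * k + 13" using dgR x sZ by blast
      ultimately show ?thesis by simp
    next
      case False
      then have "deg R y \<le> 7" if "y \<in> Z" for y using that by force
      then have "(\<Sum>v\<in>Z. deg R v) \<le> of_nat (card Z) * 7" by (rule sum_bounded_above)
      then show ?thesis using sZ by simp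
    qed
  qed
  have "(\<Sum>v\<in>W. deg R v) = (\<Sum>v\<in>Y1. deg R v) + (\<Sum>v\<in>Y2. deg R v) + (\<Sum>v\<in>\<Union>F. deg R v)"
  proof -
    have "finite (\<Union>F)" using W(1) by (auto simp: W_def)
    then show ?thesis
      unfolding W_def using Y finite_path5 by (simp add: sum.union_disjoint)
  qed
  moreover have "(\<Sum>v\<in>\<Union>F. deg R v) = (\<Sum>Z\<in>F. \<Sum>v\<in>Z. deg R v)"
    using Y finite_star4 by (subst sum.Union_disjoint) (auto simp: pairwise_def disjnt_def)
  moreover have "(\<Sum>Z\<in>F. \<Sum>v\<in>Z. deg R v) \<le> of_nat (card F) * (5 * k + 35)"
    using star_cost by (rule sum_bounded_above)
  moreover have "(\<Sum>v\<in>Y1. deg R v) \<le> 15 * k + 47"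
    by (rule path_cost[OF P(1)]) (simp add: W_def)
  moreover have "(\<Sum>v\<in>Y2. deg R v) \<le> 15 * k + 47"
    by (rule path_cost[OF P(1)[unfolded packing_commute[of k Y1]]]) (auto simp: W_def)
  ultimately have sumW: "(\<Sum>v\<in>W. deg R v) \<le> 30 * k + 94 + k * (5 * k + 35)"
    using Y(5) by simp
  have "deg_sum W \<le> (5 * k + 10) * (5 * k + 9)" using deg_sum_le_sq[OF W(1)] W(2) by (simp add: add.commute)
  moreover have "deg_sum U = deg_sum W + deg_sum R + 2 * (\<Sum>v\<in>W. deg R v)"
    using deg_sum_split[OF fin W(3)] unfolding R_def .
  \<comment> \<open>The products involving \<open>k\<close> are replaced by variables, which makes
    the combination linear.\<close>
  moreover have "e + 3 * d \<le> p + 3 * c + 2 * q"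
    if "w \<le> p" "e = w + x + 2 * y" "x \<le> 3 * z" "y \<le> q" "c = z + d" for e d p c q w x y z :: nat
    using that by linarith
  ultimately show "deg_sum U + 3 * (5 * k + 10) \<le> (5 * k + 10) * (5 * k + 9) + 3 * card U
    + 2 * (30 * k + 94 + k * (5 * k + 35))"
    using eeR sumW cU by blast
qed

lemma extremal_insert:
  assumes "extremal k (U - {v})" "v \<in> U" "nbrs U v = U - {v}" "finite U"
  shows "extremal (Suc k) U"
proof -
  obtain A s t where A: "A \<subseteq> U - {v}" "card A = k + 3" "s \<in> U - {v} - A" "t \<in> U - {v} - A" "s \<noteq> t"
    and e: "\<forall>u\<in>U - {v}. \<forall>w\<in>U - {v}. adj u w \<longleftrightarrow> u \<noteq> w \<and> (u \<in> A \<or> w \<in> A \<or> {u, w} = {s, t})"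
    using assms(1) unfolding extremal_def by blast
  have "finite A" "v \<notin> A" using A assms finite_subset by blast+
  have v: "adj v u \<longleftrightarrow> u \<noteq> v" "adj u v \<longleftrightarrow> u \<noteq> v" if "u \<in> U" for u
    using assms(3) that adj_commute[of u v] by (metis Diff_iff insert_iff empty_iff mem_nbrs)+
  have "adj u w \<longleftrightarrow> u \<noteq> w \<and> (u \<in> insert v A \<or> w \<in> insert v A \<or> {u, w} = {s, t})"
    if uw: "u \<in> U" "w \<in> U" for u w
    using v[OF uw(1)] v[OF uw(2)] e uw by (cases "u = v"; cases "w = v") auto
  then show ?thesis
    unfolding extremal_def using A assms(2) \<open>finite A\<close> \<open>v \<notin> A\<close>
    by (intro exI[of _ "insert v A"] exI[of _ s] exI[of _ t]) auto
qed

section \<open>Induction on the number of stars\<close>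

text \<open>The induction needs the structure and not only the bound: the exact count for the graph
  without \<open>v\<close> leaves so many edges to \<open>v\<close> that it is adjacent to every
  other vertex, and then adding \<open>v\<close> to \<open>A\<close> gives the extremal graph for
  \<open>k + 1\<close>.\<close>

theorem forest_extremal:
  assumes "finite U" "\<not> packs k U" "21 * k + 38 \<le> card U"
    "2 * (k + 3) * card U + 2 \<le> deg_sum U + (k + 3) * (k + 4)"
  shows "extremal k U"
  using assms
proof (induction k arbitrary: U)
  case 0
  have "dense U" using 0 unfolding dense_def by simp
  then show ?case using 0 packs_0 two_paths_extremal by blast
next
  case (Suc k)
  show ?case
  proof (cases "\<exists>v\<in>U. 5 * k + 14 \<le> deg U v")
    case True
    \<comment> \<open>The threshold is the \<open>5 * k + 10\<close> vertices of a packing plus four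
      leaves, so \<open>v\<close> centres a star off any packing in \<open>U - {v}\<close>.\<close>
    then obtain v where v: "v \<in> U" "5 * k + 14 \<le> deg U v" by blast
    have cU: "card U = card (U - {v}) + 1" using v Suc.prems card_Suc_Diff1[of U v] by simp
    have np: "\<not> packs k (U - {v})"
    proof
      assume "packs k (U - {v})"
      then obtain Y1 Y2 F where Y: "packing k Y1 Y2 F" "Y1 \<union> Y2 \<union> \<Union>F \<subseteq> U - {v}"
        unfolding packs_def by blast
      let ?W = "Y1 \<union> Y2 \<union> \<Union>F"
      have W: "finite ?W" "card ?W = 5 * k + 10" using card_packing[OF Y(1)] by auto
      obtain L where L: "L \<subseteq> U - ?W" "star4 (insert v L)"
        using ex_star4[of ?W U v] v(2) W by auto
      have "?W \<subseteq> U - insert v L" using Y(2) L(1) by blast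
      then have "packs k (U - insert v L)" by (rule packsI[OF Y(1)])
      then show False using packs_extend[of k U "insert v L"] L v Suc.prems(2) by blast
    qed
    have eeU: "deg_sum U = deg_sum (U - {v}) + 2 * deg U v" using Suc.prems v by (intro deg_sum_remove)
    have dv: "deg U v \<le> card (U - {v})" using deg_less_card[OF Suc.prems(1) v(1)] cU by simp
    have "2 * (k + 3) * card (U - {v}) + 2 \<le> deg_sum (U - {v}) + (k + 3) * (k + 4)"
      using Suc.prems(4) eeU dv unfolding cU by (simp add: algebra_simps)
    then have ext: "extremal k (U - {v})"
      using Suc.prems np cU by (intro Suc.IH) auto
    then have "deg_sum (U - {v}) + (k + 3) * (k + 4) = 2 * (k + 3) * card (U - {v}) + 2"
      using Suc.prems deg_sum_extremal(1) by blast
    then have "card (U - {v}) \<le> deg U v"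
      using Suc.prems(4) eeU unfolding cU by (simp add: algebra_simps)
    then have "nbrs U v = U - {v}"
      unfolding deg_def using Suc.prems(1) adj_irrefl
      by (intro card_seteq) auto
    then show ?thesis using extremal_insert[OF ext v(1)] Suc.prems(1) by blast
  next
    case False
    \<comment> \<open>Otherwise the induction hypothesis makes \<open>U\<close> extremal for
      \<open>k\<close> and fixes its number of edges, but the edge bound assumed for
      \<open>k + 1\<close> is strictly larger because \<open>card U > k + 4\<close>.\<close>
    have "packs k U"
    proof (rule ccontr)
      assume "\<not> packs k U"
      moreover have "k + 5 \<le> card U" using Suc.prems(3) by simp
      then have more: "2 * (k + 3) * card U + 2 < deg_sum U + (k + 3) * (k + 4)"
        using Suc.prems(3,4) by (simp add: algebra_simps)
      ultimately have "extremal k U" using Suc.prems by (intro Suc.IH) auto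
      then show False using deg_sum_extremal(1)[OF Suc.prems(1)] more by fastforce
    qed
    then have cost: "deg_sum U + 3 * (5 * k + 10) \<le> (5 * k + 10) * (5 * k + 9) + 3 * card U
      + 2 * (30 * k + 94 + k * (5 * k + 35))"
      using False Suc.prems by (intro bounded_degree_cost) (auto simp: not_le)
    \<comment> \<open>Measuring the order from its threshold turns the estimate into a polynomial
      inequality in \<open>k\<close> and \<open>m\<close> whose coefficients are all positive, with
      constant term 29.\<close>
    obtain m where m: "card U = 21 * k + 59 + m"
      using Suc.prems(3) le_Suc_ex[of "21 * k + 59" "card U"] by auto
    have "2 * (k + 4) * (21 * k + 59 + m) + 2 + 3 * (5 * k + 10)
      \<le> (k + 4) * (k + 5) + (5 * k + 10) * (5 * k + 9) + 3 * (21 * k + 59 + m)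
      + 2 * (30 * k + 94 + k * (5 * k + 35))"
      using cost Suc.prems(4) unfolding m by (simp add: algebra_simps)
    then have "6 * (k * k) + 2 * (k * m) + 5 * m + 4 * k + 29 \<le> 0"
      by (simp add: algebra_simps)
    then show ?thesis by simp
  qed
qed

section \<open>The extremal graph contains no copy of the forest\<close>

text \<open>Every path needs two vertices of \<open>A\<close> and every star needs one, so a packing
  would need \<open>k + 4\<close> of them, one more than there are.\<close>

lemma extremal_not_packs:
  assumes fin: "finite U" and ext: "extremal k U"
  shows "\<not> packs k U"
proof
  assume "packs k U"
  then obtain Y1 Y2 F where P: "packing k Y1 Y2 F" "Y1 \<union> Y2 \<union> \<Union>F \<subseteq> U"
    unfolding packs_def by blast
  note Y = packingD[OF P(1)]
  obtain A s t where A: "A \<subseteq> U" "card A = k + 3" "s \<in> U - A" "t \<in> U - A" "s \<noteq> t"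
    and e: "\<forall>u\<in>U. \<forall>v\<in>U. adj u v \<longleftrightarrow> u \<noteq> v \<and> (u \<in> A \<or> v \<in> A \<or> {u, v} = {s, t})"
    using ext unfolding extremal_def by blast
  have finA: "finite A" using A fin finite_subset by blast
  have out: "{u, v} = {s, t}" if "u \<in> U" "v \<in> U" "adj u v" "u \<notin> A" "v \<notin> A" for u v
    using e that by blast
  \<comment> \<open>Deleting one vertex of a \<open>P\<^sub>5\<close> leaves at least two edges, but \<open>U - A\<close> spans only one.\<close>
  have path: "2 \<le> card (A \<inter> Y)" if Ys: "path5 Y" "Y \<subseteq> U" for Y
  proof (rule ccontr)
    assume "\<not> ?thesis"
    then have c1: "card (A \<inter> Y) \<le> Suc 0" by simp
    have le1: "\<not> (u \<in> A \<and> v \<in> A)" if "u \<in> Y" "v \<in> Y" "u \<noteq> v" for u v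
      using card_le_Suc0_iff_eq[of "A \<inter> Y"] c1 finA that by blast
    obtain a b c d f where p: "distinct [a, b, c, d, f]" "adj a b" "adj b c" "adj c d" "adj d f"
      "Y = {a, b, c, d, f}"
      using Ys(1) unfolding path5_def by blast
    have U: "a \<in> U" "b \<in> U" "c \<in> U" "d \<in> U" "f \<in> U" using p Ys by auto
    have "(a \<notin> A \<and> b \<notin> A) \<and> (c \<notin> A \<and> d \<notin> A) \<or> (a \<notin> A \<and> b \<notin> A) \<and> (d \<notin> A \<and> f \<notin> A)
      \<or> (b \<notin> A \<and> c \<notin> A) \<and> (d \<notin> A \<and> f \<notin> A) \<or> (c \<notin> A \<and> d \<notin> A) \<and> (d \<notin> A \<and> f \<notin> A)
      \<or> (a \<notin> A \<and> b \<notin> A) \<and> (b \<notin> A \<and> c \<notin> A)"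
    proof -
      have "\<not> (a \<in> A \<and> b \<in> A)" "\<not> (a \<in> A \<and> c \<in> A)" "\<not> (a \<in> A \<and> d \<in> A)" "\<not> (a \<in> A \<and> f \<in> A)"
        "\<not> (b \<in> A \<and> c \<in> A)" "\<not> (b \<in> A \<and> d \<in> A)" "\<not> (b \<in> A \<and> f \<in> A)"
        "\<not> (c \<in> A \<and> d \<in> A)" "\<not> (c \<in> A \<and> f \<in> A)" "\<not> (d \<in> A \<and> f \<in> A)"
        by (rule le1; use p(1,6) in simp)+
      then show ?thesis by blast
    qed
    then have "{a, b} = {c, d} \<or> {a, b} = {d, f} \<or> {b, c} = {d, f} \<or> {c, d} = {d, f} \<or> {a, b} = {b, c}"
      using out[OF U(1,2) p(2)] out[OF U(2,3) p(3)] out[OF U(3,4) p(4)] out[OF U(4,5) p(5)] by metis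
    then show False using p(1) by (simp add: doubleton_eq_iff)
  qed
  have star: "A \<inter> Z \<noteq> {}" if Z: "star4 Z" "Z \<subseteq> U" for Z
  proof
    assume disj: "A \<inter> Z = {}"
    obtain c L where L: "card L = 4" "Z = insert c L" "\<forall>l\<in>L. adj c l"
      using Z unfolding star4_def by blast
    have "{c, l} = {s, t}" if "l \<in> L" for l
      using out[of c l] that L Z disj by auto
    then have "L \<subseteq> {s, t}" by blast
    then have "card L \<le> card {s, t}" by (intro card_mono) auto
    then show False using L A by simp
  qed
  have "k \<le> card (A \<inter> \<Union>F)"
  proof -
    have "card F * 1 \<le> (\<Sum>Z\<in>F. card (A \<inter> Z))"
    proof -
      have "1 \<le> card (A \<inter> Z)" if "Z \<in> F" for Z
      proof -
        have "Z \<subseteq> U" using that P(2) by blast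
        then have "A \<inter> Z \<noteq> {}" using star that Y(6) by blast
        then show ?thesis using finA by (simp add: Suc_le_eq card_gt_0_iff)
      qed
      then show ?thesis using sum_bounded_below[of F 1 "\<lambda>Z. card (A \<inter> Z)"] by simp
    qed
    also have "\<dots> = card (\<Union>Z\<in>F. A \<inter> Z)"
    proof (rule card_UN_disjoint[symmetric])
      show "\<forall>V\<in>F. \<forall>Z\<in>F. V \<noteq> Z \<longrightarrow> A \<inter> V \<inter> (A \<inter> Z) = {}"
        using Y(7) unfolding pairwise_def disjnt_def by blast
    qed (use Y(4) finA in auto)
    also have "(\<Union>Z\<in>F. A \<inter> Z) = A \<inter> \<Union>F" by auto
    finally show ?thesis using Y by simp
  qed
  moreover have "2 \<le> card (A \<inter> Y1)" "2 \<le> card (A \<inter> Y2)" using path Y P(2) by auto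
  moreover have "card (A \<inter> Y1) + card (A \<inter> Y2) + card (A \<inter> \<Union>F)
    = card (A \<inter> Y1 \<union> A \<inter> Y2 \<union> A \<inter> \<Union>F)"
  proof -
    have "card (A \<inter> Y1 \<union> A \<inter> Y2) = card (A \<inter> Y1) + card (A \<inter> Y2)"
      using finA Y(3) by (intro card_Un_disjoint) auto
    moreover have "card (A \<inter> Y1 \<union> A \<inter> Y2 \<union> A \<inter> \<Union>F) = card (A \<inter> Y1 \<union> A \<inter> Y2) + card (A \<inter> \<Union>F)"
      using finA Y(8) by (intro card_Un_disjoint) auto
    ultimately show ?thesis by simp
  qed
  moreover have "card (A \<inter> Y1 \<union> A \<inter> Y2 \<union> A \<inter> \<Union>F) \<le> card A" using finA by (intro card_mono) auto
  ultimately show False using A(2) by linarith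
qed

text \<open>The indices are the vertices of \<open>path_graph 5\<close>, so such an enumeration is
  an embedding of the forest restricted to one component.\<close>

lemma path5_iff_enum:
  "path5 Y \<longleftrightarrow> (\<exists>g. bij_betw g {..<5::nat} Y \<and> (\<forall>j. Suc j < 5 \<longrightarrow> adj (g j) (g (Suc j))))"
proof
  assume "path5 Y"
  then obtain a b c d e where p: "distinct [a, b, c, d, e]" "adj a b" "adj b c" "adj c d" "adj d e"
    "Y = {a, b, c, d, e}"
    unfolding path5_def by blast
  have "bij_betw ((!) [a, b, c, d, e]) {..<5} Y"
    using p(1,6) by (intro bij_betw_nth) auto
  moreover have "adj ([a, b, c, d, e] ! j) ([a, b, c, d, e] ! Suc j)" if "Suc j < 5" for j
  proof -
    have "j = 0 \<or> j = 1 \<or> j = 2 \<or> j = 3" using that by arith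
    then show ?thesis using p by (auto simp: eval_nat_numeral)
  qed
  ultimately show "\<exists>g. bij_betw g {..<5::nat} Y \<and> (\<forall>j. Suc j < 5 \<longrightarrow> adj (g j) (g (Suc j)))"
    by blast
next
  assume "\<exists>g. bij_betw g {..<5::nat} Y \<and> (\<forall>j. Suc j < 5 \<longrightarrow> adj (g j) (g (Suc j)))"
  then obtain g where g: "bij_betw g {..<5::nat} Y" "\<forall>j. Suc j < 5 \<longrightarrow> adj (g j) (g (Suc j))"
    by blast
  have five: "{..<5::nat} = {0, 1, 2, 3, 4}" by auto
  have "adj (g 0) (g 1)" "adj (g 1) (g 2)" "adj (g 2) (g 3)" "adj (g 3) (g 4)"
    using g(2)[rule_format, of 0] g(2)[rule_format, of 1] g(2)[rule_format, of 2]
      g(2)[rule_format, of 3] by (simp_all add: eval_nat_numeral)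
  moreover have "distinct [g 0, g 1, g 2, g 3, g 4]"
    using bij_betw_imp_inj_on[OF g(1)] unfolding five by (simp add: inj_on_def)
  moreover have "Y = {g 0, g 1, g 2, g 3, g 4}"
    using bij_betw_imp_surj_on[OF g(1)] unfolding five by auto
  ultimately show "path5 Y" unfolding path5_def by blast
qed

lemma star4_iff_enum:
  "star4 Z \<longleftrightarrow> (\<exists>g. bij_betw g {..4::nat} Z \<and> (\<forall>l\<in>{1..4}. adj (g 0) (g l)))"
proof
  assume Z: "star4 Z"
  then obtain c L where L: "card L = 4" "Z = insert c L" "\<forall>l\<in>L. adj c l"
    unfolding star4_def by blast
  have "finite L" using L(1) card.infinite by fastforce
  have "c \<notin> L" using L(3) adj_irrefl by blast
  obtain h where h: "bij_betw h {1..4::nat} L"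
    using finite_same_card_bij[of "{1..4::nat}" L] \<open>finite L\<close> L(1) by auto
  define g where "g = (\<lambda>j. if j = 0 then c else h j)"
  have "bij_betw g ({1..4} \<union> {0}) (L \<union> {c})"
  proof (rule bij_betw_combine)
    show "bij_betw g {1..4} L" using h by (rule bij_betw_cong[THEN iffD1, rotated]) (simp add: g_def)
    show "bij_betw g {0} {c}" by (simp add: g_def)
    show "L \<inter> {c} = {}" using \<open>c \<notin> L\<close> by simp
  qed
  moreover have "{1..4::nat} \<union> {0} = {..4}" by auto
  ultimately have "bij_betw g {..4} Z" using L(2) by simp
  moreover have "\<forall>l\<in>{1..4}. adj (g 0) (g l)"
    using L(3) bij_betwE[OF h] by (auto simp: g_def)
  ultimately show "\<exists>g. bij_betw g {..4::nat} Z \<and> (\<forall>l\<in>{1..4}. adj (g 0) (g l))" by blast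
next
  assume "\<exists>g. bij_betw g {..4::nat} Z \<and> (\<forall>l\<in>{1..4}. adj (g 0) (g l))"
  then obtain g where g: "bij_betw g {..4::nat} Z" "\<forall>l\<in>{1..4}. adj (g 0) (g l)" by blast
  have eq: "{..4::nat} = insert 0 {1..4}" by auto
  have "inj_on g {1..4}" using bij_betw_imp_inj_on[OF g(1)] unfolding eq by (simp add: inj_on_insert)
  then have "card (g ` {1..4}) = 4" by (simp add: card_image)
  moreover have "Z = insert (g 0) (g ` {1..4})"
    using bij_betw_imp_surj_on[OF g(1)] unfolding eq by auto
  ultimately show "star4 Z" unfolding star4_def using g(2) by blast
qed

end

subsection \<open>Transfer to graphs\<close>

lemma edge_pair:
  assumes "simple_graph G" "e \<in> edges G"
  obtains x y where "e = {x, y}" "x \<in> verts G" "y \<in> verts G" "x \<noteq> y"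
proof -
  have "card e = 2" "e \<subseteq> verts G" using assms by (auto simp: simple_graph_def)
  then show ?thesis using that by (auto simp: card_2_iff)
qed

text \<open>The copy built from an embedding receives only the images of edges of \<open>F\<close>,
  not the edges induced by \<open>G\<close>; this gives the equivalence that
  \<open>isomorphic\<close> asks for.\<close>

lemma graph_free_iff_embedding:
  assumes F: "simple_graph F" and G: "simple_graph G"
  shows "graph_free F G \<longleftrightarrow>
    \<not> (\<exists>\<phi>. inj_on \<phi> (verts F) \<and> \<phi> ` verts F \<subseteq> verts G \<and> (\<forall>e\<in>edges F. \<phi> ` e \<in> edges G))"
proof -
  have "\<exists>H. simple_graph H \<and> subgraph H G \<and> isomorphic F H"
    if \<phi>: "inj_on \<phi> (verts F)" "\<phi> ` verts F \<subseteq> verts G" "\<forall>e\<in>edges F. \<phi> ` e \<in> edges G" for \<phi>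
  proof (intro exI conjI)
    let ?H = "Graph (\<phi> ` verts F) ((`) \<phi> ` edges F)"
    have sub: "e \<subseteq> verts F" if "e \<in> edges F" for e using F that by (simp add: simple_graph_def)
    have im: "\<phi> ` e \<subseteq> \<phi> ` verts F" "card (\<phi> ` e) = 2" if e: "e \<in> edges F" for e
    proof -
      show "\<phi> ` e \<subseteq> \<phi> ` verts F" using sub[OF e] by (rule image_mono)
      have "card e = 2" using F e by (simp add: simple_graph_def)
      then show "card (\<phi> ` e) = 2" using card_image[OF inj_on_subset[OF \<phi>(1) sub[OF e]]] by simp
    qed
    have "finite (\<phi> ` verts F)" using F by (simp add: simple_graph_def)
    then show "simple_graph ?H"
      unfolding simple_graph_def graph.sel ball_simps(9) using im by blast
    show "subgraph ?H G"
      unfolding subgraph_def graph.sel image_subset_iff using \<phi>(2,3) by blast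
    have "{x, y} \<in> edges F \<longleftrightarrow> {\<phi> x, \<phi> y} \<in> (`) \<phi> ` edges F"
      if xy: "x \<in> verts F" "y \<in> verts F" for x y
    proof
      assume "{x, y} \<in> edges F"
      then have "\<phi> ` {x, y} \<in> (`) \<phi> ` edges F" by (rule imageI)
      then show "{\<phi> x, \<phi> y} \<in> (`) \<phi> ` edges F" by simp
    next
      assume "{\<phi> x, \<phi> y} \<in> (`) \<phi> ` edges F"
      then obtain e where e: "e \<in> edges F" "\<phi> ` {x, y} = \<phi> ` e" by auto
      then have "{x, y} = e"
        using inj_on_image_eq_iff[OF \<phi>(1), of "{x, y}" e] sub[OF e(1)] xy by simp
      then show "{x, y} \<in> edges F" using e by simp
    qed
    then show "isomorphic F ?H"
      unfolding isomorphic_def using inj_on_imp_bij_betw[OF \<phi>(1)] by (intro exI[of _ \<phi>]) simp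
  qed
  moreover have "\<exists>\<phi>. inj_on \<phi> (verts F) \<and> \<phi> ` verts F \<subseteq> verts G \<and> (\<forall>e\<in>edges F. \<phi> ` e \<in> edges G)"
    if H: "subgraph H G" "isomorphic F H" for H
  proof -
    obtain f where f: "bij_betw f (verts F) (verts H)"
      "\<forall>x\<in>verts F. \<forall>y\<in>verts F. {x, y} \<in> edges F \<longleftrightarrow> {f x, f y} \<in> edges H"
      using H(2) unfolding isomorphic_def by blast
    have "f ` e \<in> edges G" if e: "e \<in> edges F" for e
    proof -
      obtain x y where xy: "e = {x, y}" "x \<in> verts F" "y \<in> verts F"
        by (rule edge_pair[OF F e])
      then have "{f x, f y} \<in> edges H" using f(2) e by blast
      then show ?thesis using H(1) xy(1) unfolding subgraph_def by auto
    qed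
    moreover have "inj_on f (verts F)" "f ` verts F \<subseteq> verts G"
      using f(1) H(1) by (auto simp: bij_betw_def subgraph_def)
    ultimately show ?thesis by (intro exI[of _ f]) simp
  qed
  ultimately show ?thesis unfolding graph_free_def by meson
qed

lemma adjacency_graph: "simple_graph G \<Longrightarrow> adjacency (\<lambda>u v. {u, v} \<in> edges G)"
  by unfold_locales (auto simp: simple_graph_def insert_commute)

lemma verts_forbidden_forest:
  "verts (forbidden_forest k) = ({..<2} \<times> {..<5}) <+> ({..<k} \<times> {..4})"
  by (simp add: forbidden_forest_def disjoint_union_def copies_def path_graph_def star_graph_def)

lemma image_setcompr2: "h ` {g i j | i j. P i j} = {h (g i j) | i j. P i j}"
  by blast

lemma edges_forbidden_forest:
  "edges (forbidden_forest k) = {{Inl (i, j), Inl (i, Suc j)} | i j. i < 2 \<and> Suc j < 5}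
    \<union> {{Inr (i, 0), Inr (i, l)} | i l. i < k \<and> l \<in> {1..4}}"
proof -
  have 1: "edges (copies 2 (path_graph 5)) = {Pair i ` {j, Suc j} | i j. i < 2 \<and> Suc j < 5}"
    unfolding copies_def path_graph_def graph.sel by blast
  have 2: "edges (copies k (star_graph 4)) = {Pair i ` {0, l} | i l. i < k \<and> l \<in> {1..4}}"
    unfolding copies_def star_graph_def graph.sel by blast
  show ?thesis
    unfolding forbidden_forest_def disjoint_union_def graph.sel 1 2 image_setcompr2
    by (simp only: image_insert image_empty)
qed

lemma inj_on_case_sum:
  assumes "inj_on p A" "inj_on q B" "p ` A \<inter> q ` B = {}"
  shows "inj_on (case_sum p q) (A <+> B)"
proof (rule inj_onI)
  fix x y assume xy: "x \<in> A <+> B" "y \<in> A <+> B" "case_sum p q x = case_sum p q y"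
  have ne: "p a \<noteq> q b" if "a \<in> A" "b \<in> B" for a b using assms(3) that by blast
  show "x = y"
    by (cases x; cases y)
      (use xy ne ne[symmetric] inj_onD[OF assms(1)] inj_onD[OF assms(2)] in auto)
qed

lemma forest_free_iff_packs:
  assumes G: "simple_graph G"
  shows "graph_free (forbidden_forest k) G
    \<longleftrightarrow> \<not> adjacency.packs (\<lambda>u v. {u, v} \<in> edges G) k (verts G)"
proof -
  interpret adjacency "\<lambda>u v. {u, v} \<in> edges G" using G by (rule adjacency_graph)
  let ?F = "forbidden_forest k"
  have "packs k (verts G)"
    if \<phi>: "inj_on \<phi> (verts ?F)" "\<phi> ` verts ?F \<subseteq> verts G" "\<forall>e\<in>edges ?F. \<phi> ` e \<in> edges G" for \<phi>
  proof -
    define p where "p i = \<phi> ` Inl ` ({i} \<times> {..<5::nat})" for i :: nat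
    define q where "q i = \<phi> ` Inr ` ({i} \<times> {..4::nat})" for i :: nat
    have p: "path5 (p i)" if "i < 2" for i
      unfolding path5_iff_enum
    proof (intro exI conjI allI impI)
      show "bij_betw (\<lambda>j. \<phi> (Inl (i, j))) {..<5} (p i)"
      proof (rule bij_betw_imageI)
        show "inj_on (\<lambda>j. \<phi> (Inl (i, j))) {..<5}"
          using that by (auto intro!: inj_onI dest!: inj_onD[OF \<phi>(1)] simp: verts_forbidden_forest)
        show "(\<lambda>j. \<phi> (Inl (i, j))) ` {..<5} = p i" by (auto simp: p_def)
      qed
      fix j assume "Suc j < (5::nat)"
      then have "{Inl (i, j), Inl (i, Suc j)} \<in> edges ?F"
        unfolding edges_forbidden_forest using that by blast
      then have "\<phi> ` {Inl (i, j), Inl (i, Suc j)} \<in> edges G" using \<phi>(3) by blast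
      then show "{\<phi> (Inl (i, j)), \<phi> (Inl (i, Suc j))} \<in> edges G" by simp
    qed
    have q: "star4 (q i)" if "i < k" for i
      unfolding star4_iff_enum
    proof (intro exI conjI ballI)
      show "bij_betw (\<lambda>j. \<phi> (Inr (i, j))) {..4} (q i)"
      proof (rule bij_betw_imageI)
        show "inj_on (\<lambda>j. \<phi> (Inr (i, j))) {..4}"
          using that by (auto intro!: inj_onI dest!: inj_onD[OF \<phi>(1)] simp: verts_forbidden_forest)
        show "(\<lambda>j. \<phi> (Inr (i, j))) ` {..4} = q i" by (auto simp: q_def)
      qed
      fix l assume "l \<in> {1..4::nat}"
      then have "{Inr (i, 0), Inr (i, l)} \<in> edges ?F"
        unfolding edges_forbidden_forest using that by blast
      then have "\<phi> ` {Inr (i, 0), Inr (i, l)} \<in> edges G" using \<phi>(3) by blast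
      then show "{\<phi> (Inr (i, 0)), \<phi> (Inr (i, l))} \<in> edges G" by simp
    qed
    have disj: "\<phi> ` A \<inter> \<phi> ` B = {}" if "A \<subseteq> verts ?F" "B \<subseteq> verts ?F" "A \<inter> B = {}" for A B
      using inj_on_image_Int[OF \<phi>(1) that(1,2)] that(3) by simp
    have subp: "Inl ` ({i} \<times> {..<5::nat}) \<subseteq> verts ?F" if "i < 2" for i
      using that by (auto simp: verts_forbidden_forest)
    have subq: "Inr ` ({i} \<times> {..4::nat}) \<subseteq> verts ?F" if "i < k" for i
      using that by (auto simp: verts_forbidden_forest)
    have pp: "p 0 \<inter> p 1 = {}" unfolding p_def using subp by (intro disj) auto
    have pq: "p i \<inter> q j = {}" if "i < 2" "j < k" for i j
      unfolding p_def q_def using subp subq that by (intro disj) auto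
    have qq: "q i \<inter> q j = {}" if "i < k" "j < k" "i \<noteq> j" for i j
      unfolding q_def using subq that by (intro disj) auto
    \<comment> \<open>A packing stores its stars as a set, so different indices must be seen to give
      different stars; they are disjoint and nonempty.\<close>
    have "inj_on q {..<k}"
    proof (rule inj_onI)
      fix i j assume ij: "i \<in> {..<k}" "j \<in> {..<k}" "q i = q j"
      have "q i \<noteq> {}" by (auto simp: q_def)
      then show "i = j" using qq[of i j] ij by auto
    qed
    then have "card (q ` {..<k}) = k" by (simp add: card_image)
    moreover have "pairwise disjnt (q ` {..<k})"
      using qq by (auto simp: pairwise_def disjnt_def)
    moreover have "(p 0 \<union> p 1) \<inter> \<Union>(q ` {..<k}) = {}" using pq[of 0] pq[of 1] by auto
    ultimately have "packing k (p 0) (p 1) (q ` {..<k})"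
      unfolding packing_def using p[of 0] p[of 1] q pp by simp
    moreover have "p i \<subseteq> verts G" if "i < 2" for i using \<phi>(2) subp[OF that] unfolding p_def by blast
    moreover have "q i \<subseteq> verts G" if "i < k" for i using \<phi>(2) subq[OF that] unfolding q_def by blast
    ultimately show ?thesis by (intro packsI[of k "p 0" "p 1" "q ` {..<k}"]) auto
  qed
  moreover have "\<exists>\<phi>. inj_on \<phi> (verts ?F) \<and> \<phi> ` verts ?F \<subseteq> verts G \<and> (\<forall>e\<in>edges ?F. \<phi> ` e \<in> edges G)"
    if "packs k (verts G)"
  proof -
    obtain Y1 Y2 S where P: "packing k Y1 Y2 S" "Y1 \<union> Y2 \<union> \<Union>S \<subseteq> verts G"
      using \<open>packs k (verts G)\<close> unfolding packs_def by blast
    note Y = packingD[OF P(1)]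
    obtain g1 where g1: "bij_betw g1 {..<5::nat} Y1" "\<forall>j. Suc j < 5 \<longrightarrow> {g1 j, g1 (Suc j)} \<in> edges G"
      using Y(1) unfolding path5_iff_enum by blast
    obtain g2 where g2: "bij_betw g2 {..<5::nat} Y2" "\<forall>j. Suc j < 5 \<longrightarrow> {g2 j, g2 (Suc j)} \<in> edges G"
      using Y(2) unfolding path5_iff_enum by blast
    have "\<forall>Z\<in>S. \<exists>g. bij_betw g {..4::nat} Z \<and> (\<forall>l\<in>{1..4}. {g 0, g l} \<in> edges G)"
      using Y(6) unfolding star4_iff_enum by blast
    then obtain gs where gs: "\<forall>Z\<in>S. bij_betw (gs Z) {..4::nat} Z \<and> (\<forall>l\<in>{1..4}. {gs Z 0, gs Z l} \<in> edges G)"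
      by metis
    obtain h where h: "bij_betw h {0..<k} S" using ex_bij_betw_nat_finite[OF Y(4)] Y(5) by auto
    have hS: "h i \<in> S" if "i < k" for i using bij_betwE[OF h] that by auto
    define p where "p = (\<lambda>(i::nat, j::nat). if i = 0 then g1 j else g2 j)"
    define q where "q = (\<lambda>(i::nat, j::nat). gs (h i) j)"
    have g1_in: "g1 j \<in> Y1" and g2_in: "g2 j \<in> Y2" if "j < 5" for j
      using bij_betwE[OF g1(1)] bij_betwE[OF g2(1)] that by auto
    have gs_in: "gs (h i) j \<in> h i" if "i < k" "j \<le> 4" for i j
    proof -
      have "bij_betw (gs (h i)) {..4} (h i)" using gs hS[OF that(1)] by blast
      from bij_betwE[OF this] show ?thesis using that(2) by simp
    qed
    have injp: "inj_on p ({..<2} \<times> {..<5})"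
    proof (rule inj_onI, clarsimp)
      fix i j i' j' :: nat
      assume a: "i < 2" "j < 5" "i' < 2" "j' < 5" "p (i, j) = p (i', j')"
      have "i = i'"
      proof (rule ccontr)
        assume "i \<noteq> i'"
        then have "i = 0 \<and> i' \<noteq> 0 \<or> i \<noteq> 0 \<and> i' = 0" using a by auto
        then show False using a g1_in g2_in Y(3) unfolding p_def by fastforce
      qed
      then have "j = j'"
        using a inj_onD[OF bij_betw_imp_inj_on[OF g1(1)], of j j']
          inj_onD[OF bij_betw_imp_inj_on[OF g2(1)], of j j']
        by (auto simp: p_def split: if_splits)
      then show "i = i' \<and> j = j'" using \<open>i = i'\<close> by simp
    qed
    have injq: "inj_on q ({..<k} \<times> {..4})"
    proof (rule inj_onI, clarsimp)
      fix i j i' j' :: nat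
      assume a: "i < k" "j \<le> 4" "i' < k" "j' \<le> 4" "q (i, j) = q (i', j')"
      have qi: "q (i, j) \<in> h i" "q (i, j) \<in> h i'"
        using gs_in[of i j] gs_in[of i' j'] a by (auto simp: q_def)
      have "h i = h i'"
      proof (rule ccontr)
        assume "h i \<noteq> h i'"
        then have "h i \<inter> h i' = {}"
          using Y(7) hS a unfolding pairwise_def disjnt_def by blast
        then show False using qi by blast
      qed
      then have "i = i'" using inj_onD[OF bij_betw_imp_inj_on[OF h], of i i'] a by simp
      moreover have "inj_on (gs (h i)) {..4}" using gs hS[OF a(1)] bij_betw_imp_inj_on by blast
      then have "j = j'" using a \<open>i = i'\<close> by (auto simp: q_def dest: inj_onD)
      ultimately show "i = i' \<and> j = j'" by simp
    qed
    have pY: "p ` ({..<2} \<times> {..<5}) \<subseteq> Y1 \<union> Y2"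
      using g1_in g2_in by (auto simp: p_def)
    have qS: "q ` ({..<k} \<times> {..4}) \<subseteq> \<Union>S"
      using gs_in hS by (auto simp: q_def)
    have "p ` ({..<2} \<times> {..<5}) \<inter> q ` ({..<k} \<times> {..4}) = {}" using pY qS Y(8) by blast
    then have "inj_on (case_sum p q) (verts ?F)"
      unfolding verts_forbidden_forest by (rule inj_on_case_sum[OF injp injq])
    moreover have "case_sum p q ` verts ?F \<subseteq> verts G"
    proof -
      have "case_sum p q ` verts ?F = p ` ({..<2} \<times> {..<5}) \<union> q ` ({..<k} \<times> {..4})"
        unfolding verts_forbidden_forest Plus_def by (simp add: image_Un image_image)
      then show ?thesis using pY qS P(2) by blast
    qed
    moreover have "case_sum p q ` e \<in> edges G" if "e \<in> edges ?F" for e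
      using that g1(2) g2(2) gs hS unfolding edges_forbidden_forest
      by (auto simp: p_def q_def)
    ultimately show ?thesis by blast
  qed
  ultimately show ?thesis
    unfolding graph_free_iff_embedding[OF simple_forbidden_forest G] by blast
qed

lemma handshake:
  assumes G: "simple_graph G"
  shows "adjacency.deg_sum (\<lambda>u v. {u, v} \<in> edges G) (verts G) = 2 * num_edges G"
proof -
  interpret adjacency "\<lambda>u v. {u, v} \<in> edges G" using G by (rule adjacency_graph)
  have fin: "finite (verts G)" and sub: "\<And>e. e \<in> edges G \<Longrightarrow> e \<subseteq> verts G \<and> card e = 2"
    using G by (auto simp: simple_graph_def)
  have finE: "finite (edges G)" using fin sub by (intro finite_subset[of "edges G" "Pow (verts G)"]) auto
  have "deg (verts G) v = card {e \<in> edges G. v \<in> e}" if "v \<in> verts G" for v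
  proof -
    have "bij_betw (\<lambda>u. {v, u}) (nbrs (verts G) v) {e \<in> edges G. v \<in> e}"
    proof (rule bij_betw_imageI)
      show "inj_on (\<lambda>u. {v, u}) (nbrs (verts G) v)" by (auto intro!: inj_onI simp: doubleton_eq_iff)
      show "(\<lambda>u. {v, u}) ` nbrs (verts G) v = {e \<in> edges G. v \<in> e}"
      proof (intro equalityI subsetI)
        fix e assume e: "e \<in> {e \<in> edges G. v \<in> e}"
        then have "e \<in> edges G" by simp
        from edge_pair[OF G this] obtain x y where "e = {x, y}" "x \<in> verts G" "y \<in> verts G"
          by blast
        then show "e \<in> (\<lambda>u. {v, u}) ` nbrs (verts G) v"
          using e by (auto simp: image_iff insert_commute)
      qed auto
    qed
    then show ?thesis unfolding deg_def by (rule bij_betw_same_card)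
  qed
  then have "deg_sum (verts G) = (\<Sum>v\<in>verts G. card {e \<in> edges G. v \<in> e})" by (simp add: deg_sum_def)
  also have "\<dots> = 2 * card (edges G)"
  proof (rule sum_multicount[OF fin finE], intro ballI)
    fix e assume "e \<in> edges G"
    then have "{v \<in> verts G. v \<in> e} = e" "card e = 2" using sub by auto
    then show "card {v \<in> verts G. v \<in> e} = 2" by simp
  qed
  finally show ?thesis by (simp add: num_edges_def)
qed

section \<open>Extremal graphs up to isomorphism\<close>

definition extremal_graph :: "nat \<Rightarrow> 'a graph \<Rightarrow> bool" where
  "extremal_graph k G \<longleftrightarrow> adjacency.extremal (\<lambda>u v. {u, v} \<in> edges G) k (verts G)"

text \<open>Adjacency depends only on membership in \<open>A\<close> and on the pair
  \<open>s t\<close>. Hence any bijection taking \<open>A\<close> to \<open>B\<close>,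
  \<open>s\<close> to \<open>p\<close>, \<open>t\<close> to \<open>q\<close> and the remaining
  vertices to the remaining vertices is an isomorphism.\<close>

lemma extremal_graph_isomorphic:
  assumes G: "simple_graph G" "extremal_graph k G" and H: "simple_graph H" "extremal_graph k H"
    and ord: "order G = order H"
  shows "isomorphic G H"
proof -
  obtain A s t where A: "A \<subseteq> verts G" "card A = k + 3" "s \<in> verts G - A" "t \<in> verts G - A" "s \<noteq> t"
    and eG: "\<forall>u\<in>verts G. \<forall>v\<in>verts G. {u, v} \<in> edges G
      \<longleftrightarrow> u \<noteq> v \<and> (u \<in> A \<or> v \<in> A \<or> {u, v} = {s, t})"
    using G unfolding extremal_graph_def adjacency.extremal_def[OF adjacency_graph[OF G(1)]] by blast
  obtain B p q where B: "B \<subseteq> verts H" "card B = k + 3" "p \<in> verts H - B" "q \<in> verts H - B" "p \<noteq> q"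
    and eH: "\<forall>u\<in>verts H. \<forall>v\<in>verts H. {u, v} \<in> edges H
      \<longleftrightarrow> u \<noteq> v \<and> (u \<in> B \<or> v \<in> B \<or> {u, v} = {p, q})"
    using H unfolding extremal_graph_def adjacency.extremal_def[OF adjacency_graph[OF H(1)]] by blast
  have fin: "finite (verts G)" "finite (verts H)" using G H by (auto simp: simple_graph_def)
  have finAB: "finite A" "finite B" using A B fin finite_subset by blast+
  let ?C = "verts G - A - {s, t}" and ?D = "verts H - B - {p, q}"
  have "card ?C = card (verts G) - (k + 3) - 2" "card ?D = card (verts H) - (k + 3) - 2"
    using A B finAB fin by (simp_all add: card_Diff_subset)
  then obtain g where g: "bij_betw g ?C ?D"
    using finite_same_card_bij[of ?C ?D] fin ord by (auto simp: order_def)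
  obtain f where f: "bij_betw f A B" using finite_same_card_bij[OF finAB] A B by auto
  define h where "h x = (if x \<in> A then f x else if x = s then p else if x = t then q else g x)" for x
  have hA: "bij_betw h A B" using f by (rule bij_betw_cong[THEN iffD1, rotated]) (simp add: h_def)
  have hC: "bij_betw h ?C ?D" using g by (rule bij_betw_cong[THEN iffD1, rotated]) (simp add: h_def)
  have hs: "h s = p" "h t = q" using A by (auto simp: h_def)
  have hst: "bij_betw h {s, t} {p, q}" using hs A(5) B(5) by (auto simp: bij_betw_def)
  have "bij_betw h (A \<union> {s, t}) (B \<union> {p, q})"
    using B(3,4) by (intro bij_betw_combine[OF hA hst]) auto
  then have "bij_betw h (A \<union> {s, t} \<union> ?C) (B \<union> {p, q} \<union> ?D)"
    by (rule bij_betw_combine[OF _ hC]) blast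
  moreover have "A \<union> {s, t} \<union> ?C = verts G" "B \<union> {p, q} \<union> ?D = verts H" using A B by auto
  ultimately have h: "bij_betw h (verts G) (verts H)" by simp
  have hin: "h x \<in> verts H" if "x \<in> verts G" for x using bij_betwE[OF h] that by blast
  have hinj: "h x = h y \<longleftrightarrow> x = y" if "x \<in> verts G" "y \<in> verts G" for x y
    using bij_betw_imp_inj_on[OF h] that by (rule inj_on_eq_iff)
  have memA: "h x \<in> B \<longleftrightarrow> x \<in> A" if "x \<in> verts G" for x
  proof
    assume "x \<in> A"
    then show "h x \<in> B" using bij_betwE[OF hA] by blast
  next
    assume "h x \<in> B"
    then obtain a where a: "a \<in> A" "h a = h x" using bij_betw_imp_surj_on[OF hA] by (metis imageE)
    then have "a = x" using hinj[of a x] that A(1) by blast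
    then show "x \<in> A" using a(1) by simp
  qed
  have "{h x, h y} = {p, q} \<longleftrightarrow> {x, y} = {s, t}" if "x \<in> verts G" "y \<in> verts G" for x y
    using hinj[of x s] hinj[of x t] hinj[of y s] hinj[of y t] that A(3,4) hs
    by (auto simp: doubleton_eq_iff)
  then have "{x, y} \<in> edges G \<longleftrightarrow> {h x, h y} \<in> edges H" if "x \<in> verts G" "y \<in> verts G" for x y
    using eG eH hin hinj memA that by simp
  then show ?thesis unfolding isomorphic_def using h by blast
qed

lemma extremal_G3:
  assumes "k + 5 \<le> n"
  shows "extremal_graph k (G3 n k)"
  unfolding extremal_graph_def adjacency.extremal_def[OF adjacency_graph[OF simple_G3]]
proof (intro exI conjI ballI)
  let ?A = "Inl ` {..<k + 3} :: (nat + nat + nat) set"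
  let ?s = "Inr (Inl 0) :: nat + nat + nat" and ?t = "Inr (Inl 1) :: nat + nat + nat"
  have V: "verts (G3 n k) = {..<k + 3} <+> ({..<2} <+> {..<n - k - 5})"
    by (simp add: G3_def join_def disjoint_union_def complete_graph_def edgeless_graph_def)
  show "?A \<subseteq> verts (G3 n k)" "card ?A = k + 3" "?s \<in> verts (G3 n k) - ?A" "?t \<in> verts (G3 n k) - ?A"
    "?s \<noteq> ?t"
    unfolding V by (auto simp: card_image)
  fix u v assume uv: "u \<in> verts (G3 n k)" "v \<in> verts (G3 n k)"
  have E: "edges (G3 n k) = {{Inl i, Inl j} | i j. i < k + 3 \<and> j < k + 3 \<and> i \<noteq> j}
    \<union> {{Inr (Inl i), Inr (Inl j)} | i j. i < 2 \<and> j < 2 \<and> i \<noteq> j}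
    \<union> {{Inl x, Inr y} | x y. x < k + 3 \<and> y \<in> {..<2} <+> {..<n - k - 5}}"
    unfolding G3_def join_def disjoint_union_def complete_graph_def edgeless_graph_def graph.sel
      image_Un image_setcompr2 image_insert image_empty Un_empty_right by (simp only: lessThan_iff)
  show "{u, v} \<in> edges (G3 n k) \<longleftrightarrow> u \<noteq> v \<and> (u \<in> ?A \<or> v \<in> ?A \<or> {u, v} = {?s, ?t})"
    using uv unfolding E V by (auto simp: doubleton_eq_iff less_2_cases_iff)
qed

text \<open>The maximum in \<open>ex\<close> ranges over graphs on natural numbers, whereas
  \<open>G3\<close> lives on a sum type. This copy of \<open>G3\<close> witnesses that the maximum
  is attained.\<close>

definition nat_extremal_graph :: "nat \<Rightarrow> nat \<Rightarrow> nat graph" where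
  "nat_extremal_graph n k = Graph {..<n} {{u, v} | u v. u < n \<and> v < n \<and> u \<noteq> v
     \<and> (u < k + 3 \<or> v < k + 3 \<or> {u, v} = {k + 3, k + 4})}"

lemma nat_extremal_graph:
  assumes "k + 5 \<le> n"
  shows "simple_graph (nat_extremal_graph n k)" "order (nat_extremal_graph n k) = n"
    "extremal_graph k (nat_extremal_graph n k)"
proof -
  let ?G = "nat_extremal_graph n k"
  show simple: "simple_graph ?G"
    by (auto simp: simple_graph_def nat_extremal_graph_def card_insert_if)
  show "order ?G = n" by (simp add: order_def nat_extremal_graph_def)
  show "extremal_graph k ?G"
    unfolding extremal_graph_def adjacency.extremal_def[OF adjacency_graph[OF simple]]
  proof (intro exI conjI ballI)
    show "{..<k + 3} \<subseteq> verts ?G" "card {..<k + 3} = k + 3" "k + 3 \<in> verts ?G - {..<k + 3}"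
      "k + 4 \<in> verts ?G - {..<k + 3}" "k + 3 \<noteq> k + 4"
      using assms by (auto simp: nat_extremal_graph_def)
    fix u v assume "u \<in> verts ?G" "v \<in> verts ?G"
    then show "{u, v} \<in> edges ?G
      \<longleftrightarrow> u \<noteq> v \<and> (u \<in> {..<k + 3} \<or> v \<in> {..<k + 3} \<or> {u, v} = {k + 3, k + 4})"
      unfolding nat_extremal_graph_def by (auto simp: doubleton_eq_iff)
  qed
qed

lemma extremal_graph_edges:
  assumes "simple_graph G" "extremal_graph k G"
  shows "2 * num_edges G + (k + 3) * (k + 4) = 2 * (k + 3) * order G + 2"
  using adjacency.deg_sum_extremal(1)[OF adjacency_graph[OF assms(1)], of "verts G" k] assms
  by (simp add: handshake extremal_graph_def order_def simple_graph_def)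

lemma extremal_graph_free:
  assumes "simple_graph G" "extremal_graph k G"
  shows "graph_free (forbidden_forest k) G"
  using adjacency.extremal_not_packs[OF adjacency_graph[OF assms(1)], of "verts G" k] assms
  by (simp add: forest_free_iff_packs extremal_graph_def simple_graph_def)

lemma dense_forest_free_extremal:
  assumes "simple_graph G" "graph_free (forbidden_forest k) G" "21 * k + 38 \<le> order G"
    "2 * (k + 3) * order G + 2 \<le> 2 * num_edges G + (k + 3) * (k + 4)"
  shows "extremal_graph k G"
  using adjacency.forest_extremal[OF adjacency_graph[OF assms(1)], of "verts G" k] assms
  by (simp add: handshake forest_free_iff_packs extremal_graph_def order_def simple_graph_def)

theorem theorem8:
  fixes n k :: nat
  assumes "n \<ge> 21 * k + 38"
  shows "ex n (forbidden_forest k) = num_edges (G3 n k)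
    \<and> real (num_edges (G3 n k)) =
        (real k + 3) * real n - ((real k)\<^sup>2 + 7 * real k + 10) / 2
    \<and> simple_graph (G3 n k) \<and> order (G3 n k) = n \<and> graph_free (forbidden_forest k) (G3 n k)
    \<and> (\<forall>G :: 'a graph. simple_graph G \<and> order G = n \<and> graph_free (forbidden_forest k) G
          \<and> num_edges G = num_edges (G3 n k) \<longrightarrow> isomorphic G (G3 n k))"
proof -
  have n: "k + 5 \<le> n" using assms by simp
  note G3 = simple_G3[of n k] extremal_G3[OF n] order_G3[OF n]
  have e: "2 * num_edges (G3 n k) + (k + 3) * (k + 4) = 2 * (k + 3) * n + 2"
    using extremal_graph_edges[OF G3(1,2)] G3(3) by simp
  \<comment> \<open>The vertex type is generic here: natural numbers are used for the maximum, and
    the type of the theorem for uniqueness.\<close>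
  have ext: "extremal_graph k G"
    if "simple_graph G" "order G = n" "graph_free (forbidden_forest k) G"
      "num_edges (G3 n k) \<le> num_edges G" for G :: "'b graph"
    using that e assms by (intro dense_forest_free_extremal) auto
  have edges: "num_edges G = num_edges (G3 n k)"
    if "simple_graph G" "order G = n" "extremal_graph k G" for G :: "'b graph"
    using extremal_graph_edges[of G k] that e by simp
  let ?S = "{num_edges G | G :: nat graph. simple_graph G \<and> order G = n \<and> graph_free (forbidden_forest k) G}"
  \<comment> \<open>A free graph with more edges would still be extremal by \<open>ext\<close>, and
    extremal graphs of order \<open>n\<close> all have the same number of edges.\<close>
  have le: "m \<le> num_edges (G3 n k)" if m: "m \<in> ?S" for m
  proof (rule ccontr)
    assume "\<not> ?thesis"
    moreover obtain G :: "nat graph" where "m = num_edges G" "simple_graph G" "order G = n"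
      "graph_free (forbidden_forest k) G" using m by blast
    ultimately show False using ext[of G] edges[of G] by simp
  qed
  have "num_edges (G3 n k) \<in> ?S"
    using nat_extremal_graph[OF n] edges[of "nat_extremal_graph n k"]
      extremal_graph_free[of "nat_extremal_graph n k" k] by force
  then have "ex n (forbidden_forest k) = num_edges (G3 n k)"
    unfolding ex_def using le by (intro Max_eqI finite_subset[of ?S "{..num_edges (G3 n k)}"]) auto
  moreover have "2 * real (num_edges (G3 n k)) + (real k + 3) * (real k + 4) = 2 * (real k + 3) * real n + 2"
    using arg_cong[OF e, of real] by simp
  then have "real (num_edges (G3 n k)) = (real k + 3) * real n - ((real k)\<^sup>2 + 7 * real k + 10) / 2"
    by (simp add: field_simps power2_eq_square)
  moreover have "isomorphic G (G3 n k)"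
    if "simple_graph G" "order G = n" "graph_free (forbidden_forest k) G"
      "num_edges G = num_edges (G3 n k)" for G :: "'a graph"
    using ext[of G] that G3 by (intro extremal_graph_isomorphic[of G k]) auto
  ultimately show ?thesis using G3 extremal_graph_free[OF G3(1,2)] by blast
qed

end
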